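(* Let $(X,\tau_X)$ be a Polish space and $T:X\to X$ be $\tau_X$-continuous. Assume $X$ is endowed with a Hausdorff topology $\tau$ coarser than $\tau_X$ such that every point has a $\tau_X$-neighbourhood basis consisting of $\tau$-compact sets, and that $T$ is a homeomorphism of $(X,\tau)$. Then the following are equivalent: (1) $T$ admits an ergodic Borel probability measure with full support; (2) there exists $x_0\in X$ such that for every nonempty $\tau_X$-open set $V$, $$\lim_{N\to\infty}\underline{\mathrm{dens}}\bigcup_{r=0}^N\big(\mathcal N_T(x_0,V)-r\big)=1.$$
   Context: $\mathcal N_T(x,V)=\{n\in\mathbb N:T^nx\in V\}$; $D-r=\{d-r: d\in D\}$; $\underline{\mathrm{dens}}(D)=\liminf_N\frac1N\#(D\cap[1,N])$. Full support means positive measure on every nonempty $\tau_X$-open set. *)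

theory Defs
  imports "HOL-Probability.Probability"
begin

definition return_times :: "('a \<Rightarrow> 'a) \<Rightarrow> 'a \<Rightarrow> 'a set \<Rightarrow> int set" where
  "return_times T x V = {int n | n. n \<ge> 1 \<and> (T ^^ n) x \<in> V}"

definition shift_set :: "int set \<Rightarrow> nat \<Rightarrow> int set" where
  "shift_set D r = (\<lambda>d. d - int r) ` D"

text \<open>Lower density: liminf_N #(D cap [1,N]) / N  (valued in ereal to use liminf).\<close>
definition lower_dens :: "int set \<Rightarrow> ereal" where
  "lower_dens D = liminf (\<lambda>N::nat. ereal (real (card (D \<inter> {1..int N})) / real N))"

definition ergodic_borel_prob :: "('a::topological_space \<Rightarrow> 'a) \<Rightarrow> 'a measure \<Rightarrow> bool" where
  "ergodic_borel_prob T M \<longleftrightarrow>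
     prob_space M \<and> sets M = sets borel \<and> T \<in> measurable M M \<and> distr M M T = M \<and>
     (\<forall>A \<in> sets M. T -` A \<inter> space M = A \<longrightarrow> measure M A = 0 \<or> measure M A = 1)"

definition full_support :: "'a::topological_space measure \<Rightarrow> bool" where
  "full_support M \<longleftrightarrow> (\<forall>U. open U \<and> U \<noteq> {} \<longrightarrow> emeasure M U > 0)"

end

theory Submission
  imports Defs
begin

text \<open>
  The frequency of visits of the orbit of \<open>x\<close> to \<open>\<Union>r\<le>N. T\<^sup>-\<^sup>r V\<close> is what condition (2) measures, so
  (1) implies (2) by Birkhoff's theorem, since by ergodicity these sets exhaust \<open>X\<close> up to a null set.

  For the converse, replace \<open>V\<close> by a \<open>\<tau>\<close>-compact set \<open>K\<close> with nonempty interior: the sets \<open>\<Union>r\<le>N. T\<^sup>-\<^sup>r K\<close> are \<open>\<tau>\<close>-compact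
  and carry almost all of the orbit of \<open>x\<^sub>0\<close>, so the empirical measures are \<open>\<tau>\<close>-tight and have an invariant
  limit \<open>M\<close>, with \<open>M (\<Union>r. T\<^sup>-\<^sup>r K) = 1\<close>. The measure \<open>M\<close> need not be ergodic, but by Birkhoff's theorem
  \<open>M\<close>-almost every point again has tight empirical measures. The limit \<open>M\<^sub>x\<close> obtained from a generic \<open>x\<close> agrees with
  the visit frequencies on a countable generator of the Borel sets (outer regularity of \<open>M\<close> provides the upper bound).
  Integrating over \<open>x\<close> shows that the \<open>M\<^sub>x\<close>-variance of time averages tends to zero along a subsequence, hence \<open>M\<^sub>x\<close> is
  ergodic, and \<open>M\<^sub>x (\<Union>r. T\<^sup>-\<^sup>r K) = 1\<close> forces full support.
\<close>

section \<open>Birkhoff's theorem for bounded functions\<close>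

text \<open>At \<open>n = 0\<close> the quotient is \<open>0\<close> by the convention on division,
  so the uniform bounds on averages hold for every \<open>n\<close>.\<close>

definition time_avg :: "('a \<Rightarrow> 'a) \<Rightarrow> ('a \<Rightarrow> real) \<Rightarrow> nat \<Rightarrow> 'a \<Rightarrow> real" where
  "time_avg T f n x = (\<Sum>k<n. f ((T ^^ k) x)) / real n"

lemma abs_time_avg_le:
  assumes "\<And>x. \<bar>f x\<bar> \<le> C"
  shows "\<bar>time_avg T f n x\<bar> \<le> C"
proof -
  have "C \<ge> 0"
    using assms[of undefined] by linarith
  have "\<bar>\<Sum>k<n. f ((T ^^ k) x)\<bar> \<le> real n * C"
    by (rule order_trans[OF sum_abs]) (use sum_bounded_above[of "{..<n}" "\<lambda>k. \<bar>f ((T ^^ k) x)\<bar>" C] assms in auto)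
  then show ?thesis
    using \<open>C \<ge> 0\<close> by (cases "n = 0") (auto simp: time_avg_def field_simps)
qed

text \<open>The two Birkhoff sums differ only by the boundary terms
  \<open>f ((T ^^ n) x) - f x\<close>, which stay bounded while \<open>n\<close> grows. Invariance
  of upper averages and of orbit means rests on this.\<close>

lemma time_avg_shift_tendsto:
  assumes "\<And>x. \<bar>f x\<bar> \<le> C"
  shows "(\<lambda>n. time_avg T f n (T x) - time_avg T f n x) \<longlonglongrightarrow> 0"
proof (rule Lim_null_comparison)
  have "time_avg T f n (T x) - time_avg T f n x = (f ((T ^^ n) x) - f x) / real n" for n
  proof -
    have "(\<Sum>k<n. f ((T ^^ k) (T x))) - (\<Sum>k<n. f ((T ^^ k) x)) = (\<Sum>k<n. f ((T ^^ Suc k) x) - f ((T ^^ k) x))"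
      by (simp add: sum_subtractf funpow_swap1)
    also have "\<dots> = f ((T ^^ n) x) - f x"
      by (subst sum_lessThan_telescope) simp
    finally show ?thesis
      by (simp add: time_avg_def flip: diff_divide_distrib)
  qed
  moreover have "\<bar>f ((T ^^ n) x) - f x\<bar> \<le> 2 * C" for n
    using assms[of "(T ^^ n) x"] assms[of x] by linarith
  ultimately show "\<forall>\<^sub>F n in sequentially. norm (time_avg T f n (T x) - time_avg T f n x) \<le> 2 * C / real n"
    by (auto simp: divide_right_mono)
  show "(\<lambda>n. 2 * C / real n) \<longlonglongrightarrow> 0"
    by (rule lim_const_over_n)
qed

lemma limsup_ereal_eq_of_diff_tendsto_0:
  fixes a b :: "nat \<Rightarrow> real"
  assumes "(\<lambda>n. a n - b n) \<longlonglongrightarrow> 0"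
  shows "limsup (\<lambda>n. ereal (a n)) = limsup (\<lambda>n. ereal (b n))"
proof -
  have "limsup (\<lambda>n. ereal (a n - b n) + ereal (b n)) = 0 + limsup (\<lambda>n. ereal (b n))"
    by (rule ereal_limsup_lim_add) (use assms in \<open>auto simp: zero_ereal_def\<close>)
  then show ?thesis
    by simp
qed

lemma (in prob_space) integrable_bounded:
  fixes f :: "'a \<Rightarrow> real"
  assumes "f \<in> borel_measurable M" "\<And>x. \<bar>f x\<bar> \<le> C"
  shows "integrable M f"
  using assms by (intro integrable_const_bound[of _ C]) auto

section \<open>Invariant probability measures and the maximal inequality\<close>

locale invariant_prob = prob_space M for M :: "'a measure" +
  fixes T :: "'a \<Rightarrow> 'a"
  assumes T_measurable [measurable]: "T \<in> measurable M M"
    and T_invariant: "distr M M T = M"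
begin

lemma funpow_measurable [measurable]: "(T ^^ k) \<in> measurable M M"
proof (induction k)
  case (Suc k)
  then show ?case
    using measurable_comp[OF Suc T_measurable] by simp
qed (simp add: id_def)

lemma measurable_comp_funpow:
  "f \<in> measurable M N \<Longrightarrow> (\<lambda>x. f ((T ^^ k) x)) \<in> measurable M N"
  by (rule measurable_compose[OF funpow_measurable])

lemma measurable_comp_T:
  "f \<in> measurable M N \<Longrightarrow> (\<lambda>x. f (T x)) \<in> measurable M N"
  by (rule measurable_compose[OF T_measurable])

lemma time_avg_measurable [measurable]:
  assumes "f \<in> borel_measurable M"
  shows "time_avg T f n \<in> borel_measurable M"
proof -
  have "(\<lambda>x. (\<Sum>k<n. f ((T ^^ k) x)) / real n) \<in> borel_measurable M"
    by (intro borel_measurable_divide borel_measurable_sum measurable_comp_funpow[OF assms]) auto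
  then show ?thesis
    by (simp add: time_avg_def[abs_def])
qed

lemma integral_comp_T:
  fixes f :: "'a \<Rightarrow> real"
  assumes [measurable]: "f \<in> borel_measurable M"
  shows "(\<integral>x. f (T x) \<partial>M) = (\<integral>x. f x \<partial>M)"
  using integral_distr[of T M M f] by (simp add: T_invariant)

lemma measure_vimage_T:
  assumes "A \<in> sets M"
  shows "measure M (T -` A \<inter> space M) = measure M A"
  using measure_distr[of T M M A] assms by (simp add: T_invariant)

lemma measure_vimage_funpow:
  assumes [measurable]: "A \<in> sets M"
  shows "measure M ((T ^^ k) -` A \<inter> space M) = measure M A"
proof (induction k)
  case (Suc k)
  have "(T ^^ Suc k) -` A \<inter> space M = T -` ((T ^^ k) -` A \<inter> space M) \<inter> space M"
    using measurable_space[OF T_measurable] by (auto simp: funpow_swap1)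
  moreover have "(T ^^ k) -` A \<inter> space M \<in> sets M"
    by measurable
  ultimately show ?case
    using Suc measure_vimage_T[of "(T ^^ k) -` A \<inter> space M"] by (simp only:)
qed (simp add: assms)

text \<open>Garsia's argument: the running maxima \<open>F n\<close> of the Birkhoff sums satisfy
  \<open>F (n + 1) = f + max 0 (F n \<circ> T)\<close>, so that \<open>0 \<le> \<integral> F (n + 1) - F n = \<integral> f + \<integral> max 0 (- F n \<circ> T)\<close>,
  where the last integral vanishes in the limit.\<close>

lemma integral_nonneg_of_unbounded_sums:
  fixes f :: "'a \<Rightarrow> real"
  assumes [measurable]: "f \<in> borel_measurable M" and C: "\<And>x. \<bar>f x\<bar> \<le> C"
    and unb: "\<And>x B. x \<in> space M \<Longrightarrow> \<exists>n. (\<Sum>k<n. f ((T ^^ k) x)) > B"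
  shows "(\<integral>x. f x \<partial>M) \<ge> 0"
proof -
  have C0: "C \<ge> 0"
    using C[of undefined] by linarith
  define F where "F = rec_nat f (\<lambda>n Fn x. f x + max 0 (Fn (T x)))"
  have F0: "F 0 = f" and FS: "F (Suc n) = (\<lambda>x. f x + max 0 (F n (T x)))" for n
    by (simp_all add: F_def)
  have Fm [measurable]: "F n \<in> borel_measurable M" for n
  proof (induction n)
    case (Suc n)
    note Suc[THEN measurable_comp_T, measurable]
    show ?case
      unfolding FS by measurable
  qed (simp add: F0)
  note Fm[THEN measurable_comp_T, measurable]
  have Fb: "\<bar>F n x\<bar> \<le> real (Suc n) * C" for n x
  proof (induction n arbitrary: x)
    case (Suc n)
    show ?case
      using Suc[of "T x"] C[of x] C0 unfolding FS by (auto simp: algebra_simps max_def abs_if split: if_splits)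
  qed (use C in \<open>simp add: F0\<close>)
  have mono1: "F n x \<le> F (Suc n) x" for n x
  proof (induction n arbitrary: x)
    case 0
    then show ?case by (simp add: F0 FS)
  next
    case (Suc n)
    show ?case
      unfolding FS[of "Suc n"] by (subst FS) (use Suc[of "T x"] in auto)
  qed
  have Fmono: "F m x \<le> F n x" if "m \<le> n" for m n x
    using that by (rule lift_Suc_mono_le[where f = "\<lambda>n. F n x", rotated]) (rule mono1)
  have FS_ge: "(\<Sum>k<Suc n. f ((T ^^ k) x)) \<le> F n x" for n x
  proof (induction n arbitrary: x)
    case 0
    then show ?case by (simp add: F0)
  next
    case (Suc n)
    have "(\<Sum>k<Suc (Suc n). f ((T ^^ k) x)) = f x + (\<Sum>k<Suc n. f ((T ^^ k) (T x)))"
      by (subst sum.lessThan_Suc_shift) (simp add: funpow_swap1)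
    also have "\<dots> \<le> f x + F n (T x)"
      using Suc[of "T x"] by simp
    also have "\<dots> \<le> F (Suc n) x"
      by (simp add: FS)
    finally show ?case .
  qed
  have Fpos: "\<exists>n. F n x \<ge> 0" if x: "x \<in> space M" for x
  proof -
    obtain n where n: "(\<Sum>k<n. f ((T ^^ k) x)) > 0"
      using unb[OF x] by blast
    then obtain m where "n = Suc m"
      by (cases n) auto
    then show ?thesis
      using FS_ge[of x m] n by (intro exI[of _ m]) auto
  qed
  have I [simp]: "integrable M (F n)" "integrable M (\<lambda>x. F n (T x))" "integrable M f" for n
    by (rule integrable_bounded[OF _ Fb] integrable_bounded[of f C, OF _ C]; measurable)+
  have I2: "integrable M (\<lambda>x. max 0 (- F n (T x)))" for n
    by (rule integrable_max) auto
  have key: "(\<integral>x. f x \<partial>M) + (\<integral>x. max 0 (- F n (T x)) \<partial>M) \<ge> 0" for n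
  proof -
    have "0 \<le> (\<integral>x. F (Suc n) x - F n x \<partial>M)"
      using mono1 by (intro integral_nonneg_AE) (auto simp del: I)
    also have "\<dots> = (\<integral>x. F (Suc n) x \<partial>M) - (\<integral>x. F n (T x) \<partial>M)"
      by (simp add: integral_comp_T)
    also have "\<dots> = (\<integral>x. F (Suc n) x - F n (T x) \<partial>M)"
      by simp
    \<comment> \<open>Pointwise, \<open>max 0 a - a = max 0 (- a)\<close> with
      \<open>a = F n (T x)\<close>.\<close>
    also have "\<dots> = (\<integral>x. f x + max 0 (- F n (T x)) \<partial>M)"
      by (intro Bochner_Integration.integral_cong) (auto simp: FS max_def)
    also have "\<dots> = (\<integral>x. f x \<partial>M) + (\<integral>x. max 0 (- F n (T x)) \<partial>M)"
      by (simp add: I2)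
    finally show ?thesis .
  qed
  have "(\<lambda>n. \<integral>x. max 0 (- F n (T x)) \<partial>M) \<longlonglongrightarrow> (\<integral>x. 0 \<partial>M)"
  proof (rule integral_dominated_convergence[where w = "\<lambda>_. C"])
    show "AE x in M. (\<lambda>n. max 0 (- F n (T x))) \<longlonglongrightarrow> 0"
    proof (rule AE_I2)
      fix x assume x: "x \<in> space M"
      then obtain m where m: "F m (T x) \<ge> 0"
        using Fpos measurable_space[OF T_measurable] by blast
      show "(\<lambda>n. max 0 (- F n (T x))) \<longlonglongrightarrow> 0"
        by (rule tendsto_eventually, rule eventually_sequentiallyI[of m])
          (use Fmono[of m _ "T x"] m in fastforce)
    qed
    \<comment> \<open>Every \<open>F n\<close> dominates \<open>F 0 = f\<close>, so
      \<open>- F n\<close> never exceeds \<open>C\<close>.\<close>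
    show "AE x in M. norm (max 0 (- F n (T x))) \<le> C" for n
      using Fmono[of 0 n "T x" for x] C C0 by (intro AE_I2) (auto simp: F0 max_def; smt (verit))
  qed auto
  then have "(\<lambda>n. (\<integral>x. f x \<partial>M) + (\<integral>x. max 0 (- F n (T x)) \<partial>M)) \<longlonglongrightarrow> (\<integral>x. f x \<partial>M) + 0"
    by (intro tendsto_intros) simp
  then show ?thesis
    using key by (intro LIMSEQ_le_const[of _ "\<integral>x. f x \<partial>M"]) auto
qed

text \<open>The upper average \<open>h\<close> is invariant, so a Birkhoff sum of
  \<open>f - h + e\<close> is \<open>n\<close> times the difference of the average of
  \<open>f\<close> and \<open>h\<close>, increased by \<open>e\<close>. The average exceeds
  \<open>h - e / 2\<close> infinitely often, so these sums are unbounded and Garsia's argument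
  applies; finally \<open>e\<close> tends to \<open>0\<close>.\<close>

lemma integral_limsup_time_avg_le:
  assumes [measurable]: "f \<in> borel_measurable M" and C: "\<And>x. \<bar>f x\<bar> \<le> C"
  defines "h \<equiv> \<lambda>x. real_of_ereal (limsup (\<lambda>n. ereal (time_avg T f n x)))"
  shows "h \<in> borel_measurable M" "\<And>x. ereal (h x) = limsup (\<lambda>n. ereal (time_avg T f n x))"
    "\<And>x. \<bar>h x\<bar> \<le> C" "(\<integral>x. h x \<partial>M) \<le> (\<integral>x. f x \<partial>M)"
proof -
  show h_meas [measurable]: "h \<in> borel_measurable M"
    unfolding h_def by measurable
  have bnd: "- C \<le> time_avg T f n x" "time_avg T f n x \<le> C" for n x
    using abs_time_avg_le[of f C T n x] C by auto
  have up: "limsup (\<lambda>n. ereal (time_avg T f n x)) \<le> ereal C" for x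
    by (rule Limsup_bounded) (simp add: bnd)
  have "ereal (- C) \<le> liminf (\<lambda>n. ereal (time_avg T f n x))" for x
    by (rule Liminf_bounded) (use bnd in auto)
  then have lo: "ereal (- C) \<le> limsup (\<lambda>n. ereal (time_avg T f n x))" for x
    by (rule order_trans) (rule Liminf_le_Limsup, simp)
  show heq: "ereal (h x) = limsup (\<lambda>n. ereal (time_avg T f n x))" for x
    unfolding h_def using up[of x] lo[of x] by (intro ereal_real') auto
  show hC: "\<bar>h x\<bar> \<le> C" for x
    using up[of x] lo[of x] unfolding heq[symmetric] by auto
  have inv: "h (T x) = h x" for x
    unfolding h_def using limsup_ereal_eq_of_diff_tendsto_0[OF time_avg_shift_tendsto[of f C T x], OF C] by simp
  have invk: "h ((T ^^ k) x) = h x" for k x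
    by (induction k) (auto simp: inv)
  have int: "integrable M f" "integrable M h"
    using C hC by (auto intro!: integrable_bounded)
  have "(\<integral>x. h x \<partial>M) \<le> (\<integral>x. f x \<partial>M) + e" if e: "e > 0" for e :: real
  proof -
    have "(\<integral>x. f x - h x + e \<partial>M) \<ge> 0"
    proof (rule integral_nonneg_of_unbounded_sums)
      show "\<bar>f x - h x + e\<bar> \<le> 2 * C + e" for x
        using C[of x] hC[of x] e by linarith
      fix x B assume "x \<in> space M"
      \<comment> \<open>An average above \<open>h x - e / 2\<close> leaves a surplus of at least
        \<open>e / 2\<close> per step, so any such index beyond \<open>N\<close> gives a sum above
        \<open>B\<close>.\<close>
      obtain N where N: "real N * (e / 2) > B"
        using reals_Archimedean3[of "e / 2"] e by auto
      have "limsup (\<lambda>n. ereal (time_avg T f n x)) > ereal (h x - e / 2)"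
        unfolding heq[symmetric] using e by simp
      then have "\<exists>\<^sub>F n in sequentially. ereal (time_avg T f n x) > ereal (h x - e / 2)"
        unfolding frequently_def using Limsup_bounded[of "\<lambda>n. ereal (time_avg T f n x)" "ereal (h x - e / 2)" sequentially]
        by (auto simp: not_less)
      then obtain n where n: "n > N" "time_avg T f n x > h x - e / 2"
        unfolding frequently_sequentially by (metis Suc_le_eq ereal_less_eq(3) less_ereal.simps(1))
      have "(\<Sum>k<n. f ((T ^^ k) x) - h ((T ^^ k) x) + e) = real n * (time_avg T f n x - h x + e)"
        using n by (simp add: sum.distrib sum_subtractf invk time_avg_def field_simps)
      also have "\<dots> > real n * (e / 2)"
        using n by (intro mult_strict_left_mono) auto
      finally have "(\<Sum>k<n. f ((T ^^ k) x) - h ((T ^^ k) x) + e) > real n * (e / 2)" .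
      moreover have "real N * (e / 2) \<le> real n * (e / 2)"
        using n e by (intro mult_right_mono) auto
      ultimately show "\<exists>n. (\<Sum>k<n. f ((T ^^ k) x) - h ((T ^^ k) x) + e) > B"
        using N by (intro exI[of _ n]) linarith
    qed measurable
    then show ?thesis
      using int by (simp add: prob_space)
  qed
  then show "(\<integral>x. h x \<partial>M) \<le> (\<integral>x. f x \<partial>M)"
    by (rule field_le_epsilon)
qed

text \<open>The preceding bound, applied to \<open>f\<close> and to \<open>- f\<close>, places the
  integral of \<open>f\<close> above that of the upper averages and below that of the lower
  averages. Since the lower average never exceeds the upper one, they agree almost
  everywhere.\<close>

theorem birkhoff:
  assumes [measurable]: "f \<in> borel_measurable M" and C: "\<And>x. \<bar>f x\<bar> \<le> C"
  shows "AE x in M. convergent (\<lambda>n. time_avg T f n x)"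
    and "(\<integral>x. lim (\<lambda>n. time_avg T f n x) \<partial>M) = (\<integral>x. f x \<partial>M)"
proof -
  define h where "h x = real_of_ereal (limsup (\<lambda>n. ereal (time_avg T f n x)))" for x
  define g where "g x = real_of_ereal (limsup (\<lambda>n. ereal (time_avg T (\<lambda>y. - f y) n x)))" for x
  note h = integral_limsup_time_avg_le[OF assms, folded h_def]
  have f': "(\<lambda>y. - f y) \<in> borel_measurable M" "\<And>y. \<bar>- f y\<bar> \<le> C"
    using C by auto
  note g = integral_limsup_time_avg_le[OF f', folded g_def]
  have avg_minus: "time_avg T (\<lambda>y. - f y) n x = - time_avg T f n x" for n x
    by (simp add: time_avg_def sum_negf)
  have g_eq: "ereal (- g x) = liminf (\<lambda>n. ereal (time_avg T f n x))" for x
    using g(2)[of x] ereal_Limsup_uminus[of sequentially "\<lambda>n. ereal (time_avg T f n x)"]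
    by (simp add: avg_minus uminus_ereal.simps[symmetric] del: uminus_ereal.simps)
  have le: "- g x \<le> h x" for x
    using Liminf_le_Limsup[of sequentially "\<lambda>n. ereal (time_avg T f n x)"]
    unfolding g_eq[symmetric] h(2)[symmetric] by simp
  have int: "integrable M f" "integrable M h" "integrable M g"
    using C h(1,3) g(1,3) by (auto intro!: integrable_bounded)
  have "(\<integral>x. h x + g x \<partial>M) = (\<integral>x. h x \<partial>M) + (\<integral>x. g x \<partial>M)"
    using int by simp
  moreover have "(\<integral>x. h x + g x \<partial>M) \<ge> 0"
    using le by (intro integral_nonneg_AE) (smt (verit) AE_I2)
  ultimately have hg: "(\<integral>x. h x + g x \<partial>M) = 0" and hf: "(\<integral>x. h x \<partial>M) = (\<integral>x. f x \<partial>M)"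
    using h(4) g(4) by auto
  have "AE x in M. h x + g x = 0"
    using hg int le by (subst (asm) integral_nonneg_eq_0_iff_AE) (auto intro!: AE_I2, smt (verit) le)
  then have AEh: "AE x in M. (\<lambda>n. time_avg T f n x) \<longlonglongrightarrow> h x"
  proof (rule AE_mp, intro AE_I2 impI)
    fix x assume "h x + g x = 0"
    then have "liminf (\<lambda>n. ereal (time_avg T f n x)) = ereal (h x)" "limsup (\<lambda>n. ereal (time_avg T f n x)) = ereal (h x)"
      using g_eq[of x] h(2)[of x] by (auto simp: add_eq_0_iff2)
    then have "(\<lambda>n. ereal (time_avg T f n x)) \<longlonglongrightarrow> ereal (h x)"
      by (intro Liminf_eq_Limsup) auto
    then show "(\<lambda>n. time_avg T f n x) \<longlonglongrightarrow> h x"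
      by simp
  qed
  then show "AE x in M. convergent (\<lambda>n. time_avg T f n x)"
    by (rule AE_mp) (auto intro!: AE_I2 simp: convergent_def)
  have "(\<integral>x. lim (\<lambda>n. time_avg T f n x) \<partial>M) = (\<integral>x. h x \<partial>M)"
  proof (rule integral_cong_AE)
    show "AE x in M. lim (\<lambda>n. time_avg T f n x) = h x"
      using AEh by (rule AE_mp) (auto intro!: AE_I2 limI)
  qed (use h in measurable)
  then show "(\<integral>x. lim (\<lambda>n. time_avg T f n x) \<partial>M) = (\<integral>x. f x \<partial>M)"
    using hf by simp
qed

end

section \<open>Visit frequencies\<close>

text \<open>Convergence in \<open>L1\<close> gives almost sure convergence along a subsequence. One
  good index for each \<open>e\<close> is all that the applications ask for, so no monotonicity in
  \<open>n\<close> has to be arranged.\<close>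

lemma AE_ex_less_of_integral_tendsto_0:
  fixes u :: "nat \<Rightarrow> 'a \<Rightarrow> real"
  assumes int: "\<And>n. integrable M (u n)" and nonneg: "\<And>n. AE x in M. 0 \<le> u n x"
    and lim: "(\<lambda>n. \<integral>x. u n x \<partial>M) \<longlonglongrightarrow> 0"
  shows "AE x in M. \<forall>e>0. \<exists>n. u n x < e"
proof -
  have "(\<integral>x. norm (u n x) \<partial>M) = (\<integral>x. u n x \<partial>M)" for n
  proof (rule integral_cong_AE)
    show "AE x in M. norm (u n x) = u n x"
      using nonneg[of n] by eventually_elim simp
  qed (use int in auto)
  then obtain r where "AE x in M. (\<lambda>n. u (r n) x) \<longlonglongrightarrow> 0"
    using tendsto_L1_AE_subseq[of M u, OF int] lim by auto
  then show ?thesis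
  proof (rule AE_mp, intro AE_I2 impI allI)
    fix x and e :: real assume "(\<lambda>n. u (r n) x) \<longlonglongrightarrow> 0" "e > 0"
    then have "\<forall>\<^sub>F n in sequentially. u (r n) x < e"
      by (rule order_tendstoD)
    then show "\<exists>n. u n x < e"
      by (metis eventually_happens' sequentially_bot)
  qed
qed

lemma time_avg_indicator_bounds:
  "0 \<le> time_avg S (indicator B) n x" "time_avg S (indicator B) n x \<le> 1"
  using abs_time_avg_le[of "indicator B" 1 S n x] sum_nonneg[of "{..<n}" "\<lambda>k. indicator B ((S ^^ k) x) :: real"]
  by (auto simp: time_avg_def indicator_def)

lemma time_avg_indicator_mono:
  "A \<subseteq> B \<Longrightarrow> time_avg T (indicator A) n x \<le> time_avg T (indicator B) n x"
  unfolding time_avg_def by (intro divide_right_mono sum_mono) (auto simp: indicator_def)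

lemma time_avg_indicator_square_le: "\<bar>(time_avg S (indicator B) n x)\<^sup>2\<bar> \<le> 1"
  using time_avg_indicator_bounds[where S = S and B = B and n = n and x = x] by (simp add: power_le_one)

section \<open>Almost sure visit frequencies and second moments\<close>

context invariant_prob
begin

text \<open>Where the averages diverge, \<open>lim\<close> is an arbitrary value; for measurable
  \<open>B\<close> this happens only on a null set, so facts about \<open>freq\<close> are stated
  almost everywhere.\<close>

definition freq :: "'a set \<Rightarrow> 'a \<Rightarrow> real" where
  "freq B x = lim (\<lambda>n. time_avg T (indicator B) n x)"

lemma freq_measurable [measurable]: "B \<in> sets M \<Longrightarrow> freq B \<in> borel_measurable M"
  unfolding freq_def[abs_def] by (intro borel_measurable_lim_metric time_avg_measurable) simp

lemma AE_tendsto_freq: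
  assumes "B \<in> sets M"
  shows "AE x in M. (\<lambda>n. time_avg T (indicator B) n x) \<longlonglongrightarrow> freq B x"
proof -
  have "AE x in M. convergent (\<lambda>n. time_avg T (indicator B :: 'a \<Rightarrow> real) n x)"
    by (rule birkhoff[where C = 1]) (use assms in \<open>auto simp: indicator_def\<close>)
  then show ?thesis
    by (simp add: convergent_LIMSEQ_iff freq_def)
qed

lemma AE_freq_bounds:
  assumes "B \<in> sets M"
  shows "AE x in M. 0 \<le> freq B x \<and> freq B x \<le> 1"
  using AE_tendsto_freq[OF assms]
proof (rule AE_mp, intro AE_I2 impI)
  fix x assume lim: "(\<lambda>n. time_avg T (indicator B) n x) \<longlonglongrightarrow> freq B x"
  show "0 \<le> freq B x \<and> freq B x \<le> 1"
    by (intro conjI LIMSEQ_le_const[OF lim] LIMSEQ_le_const2[OF lim] exI[of _ 0] allI impI time_avg_indicator_bounds)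
qed

lemma AE_freq_mono:
  assumes "A \<in> sets M" "B \<in> sets M" "A \<subseteq> B"
  shows "AE x in M. freq A x \<le> freq B x"
  using AE_tendsto_freq[OF assms(1)] AE_tendsto_freq[OF assms(2)]
proof eventually_elim
  case (elim x)
  show ?case
    by (rule LIMSEQ_le[OF elim]) (use time_avg_indicator_mono[OF assms(3)] in blast)
qed

lemma integrable_freq [simp]:
  assumes "B \<in> sets M"
  shows "integrable M (freq B)"
proof (rule integrable_const_bound[of _ 1])
  show "AE x in M. norm (freq B x) \<le> 1"
    using AE_freq_bounds[OF assms] by eventually_elim auto
qed (use assms in measurable)

lemma integral_freq:
  assumes "B \<in> sets M"
  shows "(\<integral>x. freq B x \<partial>M) = measure M B"
proof -
  have "(\<integral>x. freq B x \<partial>M) = (\<integral>x. indicator B x \<partial>M)"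
    unfolding freq_def by (rule birkhoff[where C = 1]) (use assms in \<open>auto simp: indicator_def\<close>)
  then show ?thesis
    using assms by simp
qed

text \<open>The integral of \<open>1 - freq (W n)\<close> is \<open>1 - measure M (W n)\<close>,
  which tends to \<open>0\<close>. Applied to entry sets, it says that almost every orbit spends
  nearly all its time within bounded distance of a visit.\<close>

lemma AE_freq_incseq:
  assumes W: "\<And>n. W n \<in> sets M" "incseq W" and full: "measure M (\<Union>n. W n) = 1"
  shows "AE x in M. \<forall>e>0. \<exists>n. 1 - e < freq (W n) x"
proof -
  have "AE x in M. \<forall>e>0. \<exists>n. 1 - freq (W n) x < e"
  proof (rule AE_ex_less_of_integral_tendsto_0)
    show "AE x in M. 0 \<le> 1 - freq (W n) x" for n
      using AE_freq_bounds[OF W(1)] by eventually_elim auto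
    have "(\<lambda>n. measure M (W n)) \<longlonglongrightarrow> 1"
      using finite_Lim_measure_incseq[of W] W full by auto
    from tendsto_diff[OF tendsto_const[of 1] this]
    show "(\<lambda>n. \<integral>x. 1 - freq (W n) x \<partial>M) \<longlonglongrightarrow> 0"
      by (simp add: W integral_freq prob_space)
  qed (simp add: W)
  then show ?thesis
    by (rule AE_mp) (auto intro!: AE_I2 simp: algebra_simps)
qed

text \<open>The differences of frequencies are nonnegative and integrate to the differences of
  measures. This later bounds the mass of a compact set under a limit measure by frequencies of open
  sets around it.\<close>

lemma AE_freq_approx:
  assumes A: "A \<in> sets M" and U: "\<And>n. U n \<in> sets M" "\<And>n. A \<subseteq> U n"
    and lim: "(\<lambda>n. measure M (U n)) \<longlonglongrightarrow> measure M A"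
  shows "AE x in M. \<forall>e>0. \<exists>n. freq (U n) x < freq A x + e"
proof -
  have "AE x in M. \<forall>e>0. \<exists>n. freq (U n) x - freq A x < e"
  proof (rule AE_ex_less_of_integral_tendsto_0)
    show "AE x in M. 0 \<le> freq (U n) x - freq A x" for n
      using AE_freq_mono[OF A U(1,2)] by eventually_elim auto
    from tendsto_diff[OF lim tendsto_const[of "measure M A"]]
    show "(\<lambda>n. \<integral>x. freq (U n) x - freq A x \<partial>M) \<longlonglongrightarrow> 0"
      by (simp add: U A integral_freq)
  qed (simp add: U A)
  then show ?thesis
    by (rule AE_mp) (auto intro!: AE_I2 simp: algebra_simps)
qed

lemma integral_time_avg_indicator:
  assumes [measurable]: "K \<in> sets M" and "n > 0"
  shows "(\<integral>x. time_avg T (indicator K) n x \<partial>M) = measure M K"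
proof -
  have "(\<integral>x. indicator K ((T ^^ k) x) \<partial>M) = measure M K" for k
  proof -
    have "(\<integral>x. (indicator K ((T ^^ k) x) :: real) \<partial>M) = (\<integral>x. indicator ((T ^^ k) -` K \<inter> space M) x \<partial>M)"
      by (intro Bochner_Integration.integral_cong) (auto simp: indicator_def)
    then show ?thesis
      by (simp add: measure_vimage_funpow)
  qed
  moreover have "integrable M (\<lambda>x. indicator K ((T ^^ k) x) :: real)" for k
    by (rule integrable_bounded[where C = 1]) (auto simp: indicator_def)
  ultimately show ?thesis
    using \<open>n > 0\<close> by (simp add: time_avg_def)
qed

text \<open>Expanding the square leaves pair correlations of \<open>K\<close> along the orbit. They
  are measures of sets in the generator used later, so the variance of an average is determined by
  the values of the measure on that generator.\<close>

lemma integral_time_avg_indicator_square: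
  assumes [measurable]: "K \<in> sets M"
  shows "(\<integral>x. (time_avg T (indicator K) n x)\<^sup>2 \<partial>M) =
    (\<Sum>i<n. \<Sum>j<n. measure M ((T ^^ i) -` K \<inter> (T ^^ j) -` K \<inter> space M)) / (real n)\<^sup>2"
proof -
  let ?E = "\<lambda>i j. (T ^^ i) -` K \<inter> (T ^^ j) -` K \<inter> space M"
  have E: "?E i j \<in> sets M" for i j
  proof -
    have "?E i j = ((T ^^ i) -` K \<inter> space M) \<inter> ((T ^^ j) -` K \<inter> space M)"
      by auto
    then show ?thesis
      by simp
  qed
  have "(\<integral>x. (time_avg T (indicator K) n x)\<^sup>2 \<partial>M) =
    (\<integral>x. (\<Sum>i<n. \<Sum>j<n. indicator (?E i j) x) / (real n)\<^sup>2 \<partial>M)"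
  proof (rule Bochner_Integration.integral_cong)
    fix x assume x: "x \<in> space M"
    have "(\<Sum>i<n. indicator K ((T ^^ i) x) :: real)\<^sup>2 = (\<Sum>i<n. \<Sum>j<n. indicator (?E i j) x)"
      unfolding power2_eq_square sum_product using x
      by (intro sum.cong refl) (auto simp: indicator_def)
    then show "(time_avg T (indicator K) n x)\<^sup>2 = (\<Sum>i<n. \<Sum>j<n. indicator (?E i j) x) / (real n)\<^sup>2"
      by (simp add: time_avg_def power_divide)
  qed simp
  also have "\<dots> = (\<Sum>i<n. \<Sum>j<n. measure M (?E i j)) / (real n)\<^sup>2"
  proof -
    have "integrable M (indicator (?E i j) :: 'a \<Rightarrow> real)" for i j
      using E[of i j] by (intro integrable_bounded[where C = 1]) (auto simp: indicator_def)
    then show ?thesis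
      using E by (simp add: Bochner_Integration.integral_sum)
  qed
  finally show ?thesis .
qed

lemma integrable_time_avg_indicator [simp]:
  assumes [measurable]: "K \<in> sets M"
  shows "integrable M (time_avg T (indicator K) n)" "integrable M (\<lambda>x. (time_avg T (indicator K) n x)\<^sup>2)"
  by (rule integrable_bounded[where C = 1], simp, rule abs_time_avg_le, simp add: indicator_def)
    (rule integrable_bounded[where C = 1], simp, rule time_avg_indicator_square_le)

lemma integral_time_avg_indicator_square_tendsto:
  assumes [measurable]: "K \<in> sets M"
  shows "(\<lambda>n. \<integral>x. (time_avg T (indicator K) n x)\<^sup>2 \<partial>M) \<longlonglongrightarrow> (\<integral>x. (freq K x)\<^sup>2 \<partial>M)"
proof (rule integral_dominated_convergence[where w = "\<lambda>_. 1"])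
  show "AE x in M. (\<lambda>n. (time_avg T (indicator K) n x)\<^sup>2) \<longlonglongrightarrow> (freq K x)\<^sup>2"
    using AE_tendsto_freq[OF assms] by eventually_elim (rule tendsto_power)
  show "AE x in M. norm ((time_avg T (indicator K) n x)\<^sup>2) \<le> 1" for n
    by (intro AE_I2) (simp only: real_norm_def time_avg_indicator_square_le)
  show "(\<lambda>x. (freq K x)\<^sup>2) \<in> borel_measurable M" "(\<lambda>x. (time_avg T (indicator K) n x)\<^sup>2) \<in> borel_measurable M" for n
    by (intro borel_measurable_power freq_measurable time_avg_measurable borel_measurable_indicator assms)+
qed simp

text \<open>Mixing in the mean on a generator makes every invariant set independent of the generator,
  hence of itself.\<close>

lemma zero_one_of_variance:
  assumes G: "G \<subseteq> sets M" "Int_stable G" "sets M = sigma_sets (space M) G"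
    and var: "\<And>K e. K \<in> G \<Longrightarrow> e > 0 \<Longrightarrow> \<exists>n>0. variance (time_avg T (indicator K) n) < e"
    and A [measurable]: "A \<in> sets M" and inv: "T -` A \<inter> space M = A"
  shows "measure M A = 0 \<or> measure M A = 1"
proof -
  have invk: "(T ^^ k) x \<in> A \<longleftrightarrow> x \<in> A" if "x \<in> space M" for k x
  proof (induction k)
    case (Suc k)
    have "(T ^^ k) x \<in> space M"
      using measurable_space[OF funpow_measurable that] .
    then show ?case
      using Suc inv by auto
  qed simp
  have indep: "measure M (A \<inter> K) = measure M A * measure M K" if K: "K \<in> G" for K
  proof -
    have [measurable]: "K \<in> sets M"
      using K G by auto
    \<comment> \<open>The covariance of \<open>A\<close> and \<open>K\<close>. Since
      \<open>A\<close> is invariant, \<open>d\<close> is also the integral over \<open>A\<close> of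
      the centred time average for every \<open>n > 0\<close>, so its square is at most the variance
      of that average.\<close>
    define d where "d = measure M (A \<inter> K) - measure M A * measure M K"
    have "d\<^sup>2 \<le> 0 + e" if e: "e > 0" for e
    proof -
      obtain n where n: "n > 0" "variance (time_avg T (indicator K) n) < e"
        using var[OF K e] by blast
      let ?h = "\<lambda>x. time_avg T (indicator K) n x - measure M K"
      have hb: "\<bar>?h x\<bar> \<le> 1" for x
        using time_avg_indicator_bounds[of T K n x] measure_nonneg[of M K] prob_le_1[of K] by linarith
      then have hb2: "\<bar>(?h x)\<^sup>2\<bar> \<le> 1" for x
        by (simp add: abs_square_le_1)
      have int_h: "integrable M (\<lambda>x. indicator A x * ?h x)" "integrable M (\<lambda>x. (indicator A x * ?h x)\<^sup>2)"
         "integrable M (\<lambda>x. (?h x)\<^sup>2)"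
        using hb hb2 by (auto intro!: integrable_bounded[where C = 1] simp: indicator_def)
      \<comment> \<open>By invariance of \<open>A\<close>, the integrand is the indicator of the
        \<open>k\<close>-th preimage of \<open>A \<inter> K\<close>.\<close>
      have k: "(\<integral>x. indicator A x * indicator K ((T ^^ k) x) \<partial>M) = measure M (A \<inter> K)" for k
      proof -
        have "(\<integral>x. (indicator A x * indicator K ((T ^^ k) x) :: real) \<partial>M) = (\<integral>x. indicator ((T ^^ k) -` (A \<inter> K) \<inter> space M) x \<partial>M)"
          by (intro Bochner_Integration.integral_cong) (auto simp: indicator_def invk)
        then show ?thesis
          using measure_vimage_funpow[of "A \<inter> K" k] by simp
      qed
      have ik: "integrable M (\<lambda>x. indicator A x * indicator K ((T ^^ k) x) :: real)" for k
        by (rule integrable_bounded[where C = 1]) (auto simp: indicator_def)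
      have "(\<integral>x. indicator A x * ?h x \<partial>M) =
          (\<integral>x. (\<Sum>k<n. indicator A x * indicator K ((T ^^ k) x)) / real n - measure M K * indicator A x \<partial>M)"
        by (simp add: time_avg_def sum_distrib_left algebra_simps)
      also have "\<dots> = d"
      proof -
        have int_s: "integrable M (\<lambda>x. (\<Sum>k<n. indicator A x * indicator K ((T ^^ k) x)) / real n)"
          by (intro integrable_divide_zero Bochner_Integration.integrable_sum ik)
        have "(\<integral>x. (\<Sum>k<n. indicator A x * indicator K ((T ^^ k) x)) / real n \<partial>M) = measure M (A \<inter> K)"
          unfolding integral_divide_zero using n by (subst Bochner_Integration.integral_sum[OF ik]) (simp add: k)
        moreover have "(\<integral>x. measure M K * indicator A x \<partial>M) = measure M K * measure M A"
          by simp
        moreover have "integrable M (\<lambda>x. measure M K * indicator A x)"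
          by (intro integrable_mult_right integrable_bounded[where C = 1]) (auto simp: indicator_def)
        ultimately show ?thesis
          by (subst Bochner_Integration.integral_diff[OF int_s]) (simp_all add: d_def)
      qed
      finally have "d\<^sup>2 = (\<integral>x. indicator A x * ?h x \<partial>M)\<^sup>2"
        by simp
      \<comment> \<open>Nonnegativity of a variance plays the part of the Cauchy-Schwarz
        inequality.\<close>
      also have "\<dots> \<le> (\<integral>x. (indicator A x * ?h x)\<^sup>2 \<partial>M)"
        using variance_positive[of "\<lambda>x. indicator A x * ?h x"] variance_eq[OF int_h(1,2)] by linarith
      also have "\<dots> \<le> (\<integral>x. (?h x)\<^sup>2 \<partial>M)"
        using int_h by (intro integral_mono) (auto simp: indicator_def)
      also have "\<dots> < e"
        using n by (simp add: integral_time_avg_indicator)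
      finally show ?thesis
        by simp
    qed
    then have "d\<^sup>2 \<le> 0"
      by (rule field_le_epsilon)
    then show ?thesis
      by (simp add: d_def)
  qed
  have "indep_set {A} G"
    using G indep by (intro indep_setI) auto
  \<comment> \<open>Independence passes from the intersection-stable family \<open>G\<close> to the
    whole sigma-algebra, which contains \<open>A\<close> itself.\<close>
  then have "indep_set (sigma_sets (space M) {A}) (sigma_sets (space M) G)"
    by (rule indep_set_sigma_sets) (auto simp: Int_stable_def G(2)[unfolded Int_stable_def])
  then have "measure M (A \<inter> A) = measure M A * measure M A"
    by (rule indep_setD) (use A G(3) in auto)
  then show ?thesis
    by simp
qed

end

section \<open>Measures from finitely additive means\<close>

text \<open>A generalized limit of the visit frequencies, defined on all subsets: the last two
  clauses place \<open>L A\<close> between the lower and the upper limit of the frequencies of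
  \<open>A\<close>.\<close>

definition orbit_mean :: "('a \<Rightarrow> 'a) \<Rightarrow> 'a \<Rightarrow> ('a set \<Rightarrow> real) \<Rightarrow> bool" where
  "orbit_mean T y L \<longleftrightarrow>
     (\<forall>A. 0 \<le> L A) \<and> (\<forall>A B. A \<inter> B = {} \<longrightarrow> L (A \<union> B) = L A + L B) \<and> (\<forall>A. L (T -` A) = L A) \<and>
     (\<forall>A c. (\<forall>\<^sub>F n in sequentially. c \<le> time_avg T (indicator A) n y) \<longrightarrow> c \<le> L A) \<and>
     (\<forall>A c. (\<forall>\<^sub>F n in sequentially. time_avg T (indicator A) n y \<le> c) \<longrightarrow> L A \<le> c)"

text \<open>By Tychonoff's theorem the frequency functions \<open>p n\<close> have a cluster point
  \<open>L\<close> in a compact cube indexed by all subsets. Each clause is then checked by passing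
  to the limit, set by set.\<close>

lemma ex_orbit_mean:
  fixes T :: "'a \<Rightarrow> 'a"
  shows "\<exists>L. orbit_mean T y L"
proof -
  define p where "p n A = time_avg T (indicator A) n y" for n A
  define Q where "Q = (UNIV :: 'a set set) \<rightarrow>\<^sub>E {0..1::real}"
  have "compact Q"
    using compactin_PiE[of "\<lambda>_. euclideanreal" "UNIV :: 'a set set" "\<lambda>_. {0..1}"]
    by (simp add: euclidean_product_topology Q_def)
  moreover have "p n A \<in> {0..1}" for n A
    by (simp add: p_def time_avg_indicator_bounds)
  then have "\<forall>\<^sub>F f in filtermap p sequentially. f \<in> Q"
    by (simp add: eventually_filtermap Q_def PiE_iff)
  moreover have "filtermap p sequentially \<noteq> bot"
    by (simp add: filtermap_bot_iff)
  ultimately obtain L where L: "inf (nhds L) (filtermap p sequentially) \<noteq> bot"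
    unfolding compact_filter by blast
  \<comment> \<open>A filter of indices finer than \<open>sequentially\<close> along which
    \<open>p\<close> converges to \<open>L\<close>; it replaces a convergent subsequence, which need
    not exist in this cube.\<close>
  define F where "F = inf (filtercomap p (nhds L)) sequentially"
  \<comment> \<open>If \<open>F\<close> were trivial, some neighbourhood of \<open>L\<close> would
    eventually be avoided by \<open>p\<close>, and \<open>L\<close> would not be a cluster
    point.\<close>
  have F: "F \<noteq> bot"
  proof
    assume "F = bot"
    then obtain P Q where PQ: "eventually P (filtercomap p (nhds L))" "eventually Q sequentially" "\<And>n. \<not> (P n \<and> Q n)"
      unfolding F_def trivial_limit_def eventually_inf by auto
    then obtain R where R: "eventually R (nhds L)" "\<And>n. R (p n) \<Longrightarrow> P n"
      unfolding eventually_filtercomap by blast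
    have "eventually (\<lambda>f. \<not> R f) (filtermap p sequentially)"
      unfolding eventually_filtermap using PQ(2) by eventually_elim (use PQ(3) R(2) in blast)
    with R(1) have "eventually (\<lambda>f. False) (inf (nhds L) (filtermap p sequentially))"
      unfolding eventually_inf by blast
    with L show False
      by (simp add: trivial_limit_def)
  qed
  have "filterlim p (nhds L) F"
    unfolding F_def by (rule filterlim_mono[OF filterlim_filtercomap]) auto
  then have lim: "((\<lambda>n. p n A) \<longlongrightarrow> L A) F" for A
    using continuous_on_tendsto_compose[OF continuous_on_product_coordinates[of A], of p L F] by auto
  have Fs: "F \<le> sequentially"
    by (simp add: F_def)
  note ev = filter_leD[OF Fs]
  show ?thesis
    unfolding orbit_mean_def
  proof (intro exI[of _ L] conjI allI impI)
    show low: "c \<le> L A" if "\<forall>\<^sub>F n in sequentially. c \<le> time_avg T (indicator A) n y" for A c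
      using tendsto_lowerbound[OF lim ev[OF that[folded p_def]] F] .
    show "L A \<le> c" if "\<forall>\<^sub>F n in sequentially. time_avg T (indicator A) n y \<le> c" for A c
      using tendsto_upperbound[OF lim ev[OF that[folded p_def]] F] .
    show "0 \<le> L A" for A
      using \<open>\<And>n A. p n A \<in> {0..1}\<close> by (intro low) (auto simp: p_def)
    show "L (A \<union> B) = L A + L B" if "A \<inter> B = {}" for A B
    proof (rule tendsto_unique[OF F lim])
      have "p n (A \<union> B) = p n A + p n B" for n
        using that by (simp add: p_def time_avg_def indicator_disj_union sum.distrib add_divide_distrib)
      then show "((\<lambda>n. p n (A \<union> B)) \<longlongrightarrow> L A + L B) F"
        using lim[of A] lim[of B] by (simp add: tendsto_add)
    qed
    show "L (T -` A) = L A" for A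
    proof (rule tendsto_unique[OF F lim])
      have "(\<lambda>n. p n (T -` A) - p n A) \<longlonglongrightarrow> 0"
      proof -
        have "p n (T -` A) = time_avg T (indicator A) n (T y)" for n
          by (simp add: p_def time_avg_def indicator_def funpow_swap1)
        then show ?thesis
          using time_avg_shift_tendsto[of "indicator A" 1 T y] by (simp add: p_def indicator_def)
      qed
      then have "((\<lambda>n. p n (T -` A) - p n A) \<longlongrightarrow> 0) F"
        using Fs by (rule tendsto_mono[rotated])
      then show "((\<lambda>n. p n (T -` A)) \<longlongrightarrow> L A) F"
        using tendsto_add[OF _ lim[of A]] by fastforce
    qed
  qed
qed

section \<open>Radon-type measures from finitely additive set functions\<close>

locale compact_content =
  fixes tau :: "'a topology" and L :: "'a set \<Rightarrow> real"
  assumes topspace_tau: "topspace tau = UNIV"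
    and Hausdorff_tau: "Hausdorff_space tau"
    and L_nonneg: "0 \<le> L A"
    and L_disjoint_Un: "A \<inter> B = {} \<Longrightarrow> L (A \<union> B) = L A + L B"
begin

lemma L_empty: "L {} = 0"
  using L_disjoint_Un[of "{}" "{}"] by simp

lemma L_mono: "A \<subseteq> B \<Longrightarrow> L A \<le> L B"
  using L_disjoint_Un[of A "B - A"] L_nonneg[of "B - A"] by (simp add: Un_absorb1)

lemma L_Un_le: "L (A \<union> B) \<le> L A + L B"
  using L_disjoint_Un[of A "B - A"] L_mono[of "B - A" B] by simp

text \<open>First stage of the construction of a Radon measure from a content; \<open>outer\<close>
  is the second. The result need not extend \<open>L\<close>: it is at least \<open>L\<close> on
  compact sets and at most \<open>L\<close> on open sets, the two inequalities of weak
  limits.\<close>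

definition inner :: "'a set \<Rightarrow> ennreal" where
  "inner U = (SUP K \<in> {K. compactin tau K \<and> K \<subseteq> U}. ennreal (L K))"

definition outer :: "'a set \<Rightarrow> ennreal" where
  "outer A = (INF U \<in> {U. openin tau U \<and> A \<subseteq> U}. inner U)"

lemma le_inner: "compactin tau K \<Longrightarrow> K \<subseteq> U \<Longrightarrow> ennreal (L K) \<le> inner U"
  unfolding inner_def by (rule SUP_upper) simp

lemma inner_mono: "U \<subseteq> V \<Longrightarrow> inner U \<le> inner V"
  unfolding inner_def by (rule SUP_subset_mono) auto

lemma inner_le: "inner U \<le> ennreal (L U)"
  unfolding inner_def by (intro SUP_least ennreal_leI L_mono) auto

lemma outer_mono: "A \<subseteq> B \<Longrightarrow> outer A \<le> outer B"
  unfolding outer_def by (rule INF_superset_mono) auto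

lemma outer_le: "openin tau U \<Longrightarrow> A \<subseteq> U \<Longrightarrow> outer A \<le> inner U"
  unfolding outer_def by (rule INF_lower) simp

lemma outer_open: "openin tau U \<Longrightarrow> outer U = inner U"
  by (rule antisym[OF outer_le]) (auto simp: outer_def intro!: INF_greatest inner_mono)

lemma outer_compact: "compactin tau K \<Longrightarrow> ennreal (L K) \<le> outer K"
  unfolding outer_def by (auto intro!: INF_greatest le_inner)

lemma outer_finite: "outer A < \<top>"
proof -
  have "outer A \<le> inner UNIV"
    using openin_topspace[of tau] by (intro outer_le) (auto simp: topspace_tau)
  also have "\<dots> \<le> ennreal (L UNIV)"
    by (rule inner_le)
  finally show ?thesis
    using ennreal_less_top le_less_trans by blast
qed

lemma outer_close:
  assumes "0 < (e :: ennreal)"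
  obtains U where "openin tau U" "A \<subseteq> U" "inner U < outer A + e"
proof -
  have "outer A < outer A + e"
    using outer_finite[of A] assms by (simp add: ennreal_add_left_cancel_less)
  then show thesis
    unfolding outer_def[of A] INF_less_iff using that by (auto simp: outer_def)
qed

text \<open>The compact sets \<open>K - U\<close> and \<open>K - V\<close> are disjoint, so they
  have disjoint open neighbourhoods. Removing one neighbourhood from \<open>K\<close> gives
  \<open>K1\<close>, removing the other gives \<open>K2\<close>.\<close>

lemma compactin_split:
  assumes K: "compactin tau K" and U: "openin tau U" and V: "openin tau V" and sub: "K \<subseteq> U \<union> V"
  obtains K1 K2 where "compactin tau K1" "compactin tau K2" "K1 \<subseteq> U" "K2 \<subseteq> V" "K = K1 \<union> K2"
proof -
  have c: "compactin tau (K - W)" if "openin tau W" for W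
  proof -
    have "closedin tau (UNIV - W)"
      using that by (metis openin_closedin_eq topspace_tau)
    moreover have "K - W = K \<inter> (UNIV - W)"
      by auto
    ultimately show ?thesis
      using compact_Int_closedin[OF K] by simp
  qed
  have "disjnt (K - U) (K - V)"
    using sub by (auto simp: disjnt_def)
  then obtain P Q where PQ: "openin tau P" "openin tau Q" "K - U \<subseteq> P" "K - V \<subseteq> Q" "disjnt P Q"
    using Hausdorff_space_compact_separation[OF Hausdorff_tau c[OF U] c[OF V]] by blast
  show thesis
    by (rule that[of "K - P" "K - Q"]) (use PQ c in \<open>auto simp: disjnt_def\<close>)
qed

lemma inner_Un_le:
  assumes "openin tau U" "openin tau V"
  shows "inner (U \<union> V) \<le> inner U + inner V"
  unfolding inner_def[of "U \<union> V"]
proof (rule SUP_least)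
  fix K assume "K \<in> {K. compactin tau K \<and> K \<subseteq> U \<union> V}"
  then have "compactin tau K" "K \<subseteq> U \<union> V"
    by auto
  from compactin_split[OF this(1) assms this(2)]
  obtain K1 K2 where K: "compactin tau K1" "compactin tau K2" "K1 \<subseteq> U" "K2 \<subseteq> V" "K = K1 \<union> K2" .
  have "ennreal (L K) \<le> ennreal (L K1) + ennreal (L K2)"
    unfolding K(5) by (simp add: ennreal_plus[symmetric] L_nonneg ennreal_leI L_Un_le del: ennreal_plus)
  also have "\<dots> \<le> inner U + inner V"
    using K by (intro add_mono le_inner)
  finally show "ennreal (L K) \<le> inner U + inner V" .
qed

lemma inner_empty: "inner {} = 0"
  using inner_le[of "{}"] by (simp add: L_empty)

lemma inner_UN_lessThan_le:
  assumes "\<And>i::nat. openin tau (U i)"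
  shows "inner (\<Union>i<n. U i) \<le> (\<Sum>i<n. inner (U i))"
proof (induction n)
  case (Suc n)
  have "inner (\<Union>i<Suc n. U i) \<le> inner (\<Union>i<n. U i) + inner (U n)"
    using inner_Un_le[of "\<Union>i<n. U i" "U n"] assms by (auto simp: lessThan_Suc Un_commute)
  also have "\<dots> \<le> (\<Sum>i<Suc n. inner (U i))"
    using Suc by (simp add: add_right_mono)
  finally show ?case .
qed (simp add: inner_empty)

text \<open>A compact subset of the union is covered by finitely many of the sets, so countable
  subadditivity reduces to the finite case.\<close>

lemma inner_UN_le:
  assumes U: "\<And>i::nat. openin tau (U i)"
  shows "inner (\<Union>i. U i) \<le> (\<Sum>i. inner (U i))"
  unfolding inner_def[of "\<Union>i. U i"]
proof (rule SUP_least)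
  fix K assume "K \<in> {K. compactin tau K \<and> K \<subseteq> (\<Union>i. U i)}"
  then have K: "compactin tau K" "K \<subseteq> \<Union>(range U)"
    by auto
  have "\<exists>\<F>. finite \<F> \<and> \<F> \<subseteq> range U \<and> K \<subseteq> \<Union>\<F>"
    by (rule compactinD[OF K(1)]) (use U K(2) in auto)
  then obtain \<F> where F: "finite \<F>" "\<F> \<subseteq> range U" "K \<subseteq> \<Union>\<F>"
    by blast
  then obtain J where J: "finite J" "\<F> = U ` J"
    by (meson finite_subset_image)
  then obtain n where "J \<subseteq> {..<n}"
    using finite_nat_bounded by blast
  then have "K \<subseteq> (\<Union>i<n. U i)"
    using F(3) J(2) by blast
  then have "ennreal (L K) \<le> inner (\<Union>i<n. U i)"
    using K by (intro le_inner)
  also have "\<dots> \<le> (\<Sum>i<n. inner (U i))"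
    by (rule inner_UN_lessThan_le[OF U])
  also have "\<dots> \<le> (\<Sum>i. inner (U i))"
    by (rule sum_le_suminf) auto
  finally show "ennreal (L K) \<le> (\<Sum>i. inner (U i))" .
qed

lemma outer_UN_le: "outer (\<Union>i::nat. A i) \<le> (\<Sum>i. outer (A i))"
proof (rule ennreal_le_epsilon)
  fix e :: real assume e: "0 < e"
  \<comment> \<open>The tolerances \<open>e * (1/2) ^ Suc i\<close> add up to
    \<open>e\<close>.\<close>
  have "\<exists>U. openin tau U \<and> A i \<subseteq> U \<and> inner U \<le> outer (A i) + ennreal (e * (1/2) ^ Suc i)" for i
    using outer_close[of "ennreal (e * (1/2) ^ Suc i)" "A i"] e by (metis ennreal_less_zero_iff less_imp_le mult_pos_pos zero_less_power half_gt_zero_iff zero_less_one)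
  then obtain U where U: "\<And>i. openin tau (U i)" "\<And>i. A i \<subseteq> U i" "\<And>i. inner (U i) \<le> outer (A i) + ennreal (e * (1/2) ^ Suc i)"
    by metis
  have "outer (\<Union>i. A i) \<le> inner (\<Union>i. U i)"
    using U by (intro outer_le) auto
  also have "\<dots> \<le> (\<Sum>i. inner (U i))"
    by (rule inner_UN_le[OF U(1)])
  also have "\<dots> \<le> (\<Sum>i. outer (A i) + ennreal (e * (1/2) ^ Suc i))"
    by (intro suminf_le U) auto
  also have "\<dots> = (\<Sum>i. outer (A i)) + (\<Sum>i. ennreal (e * (1/2) ^ Suc i))"
    by (subst suminf_add) auto
  also have "(\<Sum>i. ennreal (e * (1/2) ^ Suc i)) = ennreal e"
    using e sums_mult[OF power_half_series, of e] by (intro suminf_ennreal_eq) auto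
  finally show "outer (\<Union>i. A i) \<le> (\<Sum>i. outer (A i)) + ennreal e" .
qed

lemma outer_measure_space_outer: "outer_measure_space (Pow UNIV) outer"
  unfolding outer_measure_space_def
proof (intro conjI)
  have "outer {} \<le> inner {}"
    by (intro outer_le) auto
  then show "positive (Pow UNIV) outer"
    by (simp add: positive_def inner_empty)
  show "increasing (Pow UNIV) outer"
    by (auto simp: increasing_def intro: outer_mono)
  show "countably_subadditive (Pow UNIV) outer"
    by (auto simp: countably_subadditive_def intro: outer_UN_le)
qed

text \<open>Against an open test set \<open>V\<close>: a compact \<open>K\<close> inside
  \<open>V \<inter> P\<close> leaves the open set \<open>V - K\<close>, which contains
  \<open>V - P\<close>. Any compact \<open>J\<close> in \<open>V - K\<close> is disjoint from
  \<open>K\<close>, so additivity of \<open>L\<close> bounds \<open>L K + L J\<close> by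
  \<open>inner V\<close>. Suprema over \<open>J\<close> and then \<open>K\<close> give the
  splitting; arbitrary test sets follow by the infimum over open \<open>V\<close>.\<close>

lemma openin_in_lambda_system:
  assumes P: "openin tau P"
  shows "P \<in> lambda_system UNIV (Pow UNIV) outer"
proof -
  have split: "inner (V \<inter> P) + outer (V - P) \<le> inner V" if V: "openin tau V" for V
  proof -
    have "ennreal (L K) + outer (V - P) \<le> inner V" if K: "compactin tau K" "K \<subseteq> V \<inter> P" for K
    proof -
      have "openin tau (V - K)"
        using V compactin_imp_closedin[OF Hausdorff_tau K(1)] by (rule openin_diff)
      then have "outer (V - P) \<le> inner (V - K)"
        using K by (intro outer_le) auto
      then have "ennreal (L K) + outer (V - P) \<le> ennreal (L K) + inner (V - K)"
        by (rule add_left_mono)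
      also have "\<dots> = (SUP J \<in> {J. compactin tau J \<and> J \<subseteq> V - K}. ennreal (L K) + ennreal (L J))"
        unfolding inner_def by (subst ennreal_SUP_add_right) auto
      also have "\<dots> \<le> inner V"
      proof (rule SUP_least)
        fix J assume J: "J \<in> {J. compactin tau J \<and> J \<subseteq> V - K}"
        have "ennreal (L K) + ennreal (L J) = ennreal (L (K \<union> J))"
          using J by (subst L_disjoint_Un) (auto simp: L_nonneg)
        also have "\<dots> \<le> inner V"
          using J K by (intro le_inner compactin_Un) auto
        finally show "ennreal (L K) + ennreal (L J) \<le> inner V" .
      qed
      finally show ?thesis .
    qed
    then have "(SUP K \<in> {K. compactin tau K \<and> K \<subseteq> V \<inter> P}. ennreal (L K) + outer (V - P)) \<le> inner V"
      by (intro SUP_least) auto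
    then show ?thesis
      unfolding inner_def[of "V \<inter> P"] by (subst (asm) ennreal_SUP_add_left) (auto simp: outer_finite[THEN less_imp_neq])
  qed
  have "outer (P \<inter> E) + outer ((UNIV - P) \<inter> E) = outer E" for E
  proof (rule antisym)
    show "outer (P \<inter> E) + outer ((UNIV - P) \<inter> E) \<le> outer E"
      unfolding outer_def[of E]
    proof (rule INF_greatest)
      fix V assume "V \<in> {U. openin tau U \<and> E \<subseteq> U}"
      then have V: "openin tau V" "E \<subseteq> V"
        by auto
      have "outer (P \<inter> E) + outer ((UNIV - P) \<inter> E) \<le> inner (V \<inter> P) + outer (V - P)"
        using V P by (intro add_mono outer_le outer_mono) auto
      also have "\<dots> \<le> inner V"
        by (rule split[OF V(1)])
      finally show "outer (P \<inter> E) + outer ((UNIV - P) \<inter> E) \<le> inner V" .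
    qed
    have "subadditive (Pow UNIV) outer"
      using outer_measure_space_outer sigma_algebra_Pow[of UNIV, THEN sigma_algebra.axioms(1), THEN algebra.axioms(1)]
      by (metis outer_measure_space_def ring_of_sets.countably_subadditive_subadditive)
    from subadditiveD[OF this, of "P \<inter> E" "(UNIV - P) \<inter> E"]
    show "outer E \<le> outer (P \<inter> E) + outer ((UNIV - P) \<inter> E)"
      by (simp add: Int_Un_distrib2[symmetric] Diff_eq)
  qed
  then show ?thesis
    by (simp add: lambda_system_def)
qed

lemma measure_space_lambda_system:
  "measure_space UNIV (lambda_system UNIV (Pow UNIV) outer) outer"
  by (rule sigma_algebra.caratheodory_lemma[OF sigma_algebra_Pow outer_measure_space_outer])

end

section \<open>Limits of empirical measures\<close>

locale compactly_based_system =
  fixes T :: "'a::polish_space \<Rightarrow> 'a" and tau :: "'a topology"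
  assumes continuous_T: "continuous_on UNIV T"
    and topspace_tau: "topspace tau = UNIV"
    and Hausdorff_tau: "Hausdorff_space tau"
    and openin_tau_imp_open: "openin tau U \<Longrightarrow> open U"
    and compact_neighbourhood:
      "open U \<Longrightarrow> x \<in> U \<Longrightarrow> \<exists>K. compactin tau K \<and> x \<in> interior K \<and> K \<subseteq> U"
    and homeomorphic_T: "homeomorphic_map tau tau T"
begin

lemma bij_T: "bij T"
  using homeomorphic_imp_injective_map[OF homeomorphic_T] homeomorphic_imp_surjective_map[OF homeomorphic_T]
  by (simp add: bij_def topspace_tau)

lemma openin_vimage_T: "openin tau U \<Longrightarrow> openin tau (T -` U)"
  using homeomorphic_imp_continuous_map[OF homeomorphic_T]
  by (auto simp: continuous_map_def topspace_tau vimage_def)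

lemma openin_image_T: "openin tau U \<Longrightarrow> openin tau (T ` U)"
  using homeomorphic_imp_open_map[OF homeomorphic_T] by (simp add: open_map_def)

lemma compactin_image_T: "compactin tau K \<Longrightarrow> compactin tau (T ` K)"
  using image_compactin[OF _ homeomorphic_imp_continuous_map[OF homeomorphic_T]] .

lemma compactin_vimage_T:
  assumes "compactin tau K"
  shows "compactin tau (T -` K)"
proof -
  have "T ` (T -` K) = K"
    using bij_T by (simp add: bij_is_surj surj_image_vimage_eq)
  then show ?thesis
    using homeomorphic_map_compactness[OF homeomorphic_T, of "T -` K"] assms by (simp add: topspace_tau)
qed

lemma compactin_vimage_funpow: "compactin tau K \<Longrightarrow> compactin tau ((T ^^ k) -` K)"
proof (induction k)
  case (Suc k)
  have "(T ^^ Suc k) -` K = T -` ((T ^^ k) -` K)"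
    by (auto simp: funpow_swap1)
  then show ?case
    using Suc compactin_vimage_T by (simp only:)
qed simp

lemma T_borel [measurable]: "T \<in> borel_measurable borel"
  by (rule borel_measurable_continuous_onI[OF continuous_T])

lemma openin_borel: "openin tau U \<Longrightarrow> U \<in> sets borel"
  using openin_tau_imp_open by simp

lemma compactin_closed: "compactin tau K \<Longrightarrow> closed K"
  using compactin_imp_closedin[OF Hausdorff_tau, of K] openin_tau_imp_open[of "- K"]
  by (simp add: closedin_def topspace_tau Compl_eq_Diff_UNIV closed_def)

lemma compactin_borel: "compactin tau K \<Longrightarrow> K \<in> sets borel"
  using compactin_closed by simp

text \<open>The interiors of the \<open>tau\<close>-compact subsets cover \<open>U\<close>, and the
  Lindelof property extracts a countable subcover.\<close>

lemma open_eq_Union_compactin: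
  assumes U: "open U"
  obtains C where "countable C" "\<And>K. K \<in> C \<Longrightarrow> compactin tau K \<and> interior K \<noteq> {}" "\<Union>C = U"
proof -
  define F where "F = {K. compactin tau K \<and> interior K \<noteq> {} \<and> K \<subseteq> U}"
  obtain G where G: "G \<subseteq> interior ` F" "countable G" "\<Union>G = \<Union>(interior ` F)"
    using Lindelof[of "interior ` F"] by auto
  then obtain C where C: "C \<subseteq> F" "countable C" "G = interior ` C"
    by (metis countable_subset_image)
  have "U \<subseteq> \<Union>(interior ` F)"
    using compact_neighbourhood[OF U] by (fastforce simp: F_def)
  also have "\<dots> = \<Union>(interior ` C)"
    using G C by simp
  also have "\<dots> \<subseteq> \<Union>C"
    using interior_subset by fastforce
  finally have "\<Union>C = U"
    using C by (auto simp: F_def)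
  then show thesis
    using C by (intro that[of C]) (auto simp: F_def)
qed

text \<open>Coarsening the topology does not change the Borel sets: \<open>tau\<close>-compact sets
  are \<open>tau\<close>-closed, and every open set of the Polish topology is a countable union of
  them. So Caratheodory measurability needs checking on \<open>tau\<close>-open sets only.\<close>

lemma borel_subset_of_openin:
  assumes S: "sigma_algebra UNIV S" and sub: "\<And>U. openin tau U \<Longrightarrow> U \<in> S"
  shows "sets borel \<subseteq> S"
proof -
  interpret S: sigma_algebra UNIV S
    by (rule S)
  have compact: "K \<in> S" if "compactin tau K" for K
  proof -
    have "openin tau (UNIV - K)"
      using compactin_imp_closedin[OF Hausdorff_tau that] by (simp add: closedin_def topspace_tau)
    then show ?thesis
      using S.compl_sets[OF sub, of "UNIV - K"] by (simp add: double_diff)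
  qed
  have "U \<in> S" if "open U" for U
  proof -
    obtain C where "countable C" "\<And>K. K \<in> C \<Longrightarrow> compactin tau K \<and> interior K \<noteq> {}" "\<Union>C = U"
      using open_eq_Union_compactin[OF \<open>open U\<close>] by blast
    then show ?thesis
      using S.countable_Union[of C] compact by auto
  qed
  then show ?thesis
    unfolding borel_def using S.sigma_sets_subset[of "Collect open"] by auto
qed

text \<open>The weak limit of the empirical measures of \<open>y\<close>: tightness in \<open>tau\<close> rules out a loss of mass, and
  since \<open>T\<close> is a homeomorphism for \<open>tau\<close>, the limit is invariant.\<close>

definition orbit_measure :: "'a \<Rightarrow> 'a measure \<Rightarrow> bool" where
  "orbit_measure y M \<longleftrightarrow> sets M = sets borel \<and> invariant_prob M T \<and>
     (\<forall>K c. compactin tau K \<longrightarrow> (\<forall>\<^sub>F n in sequentially. c \<le> time_avg T (indicator K) n y) \<longrightarrow> c \<le> measure M K) \<and>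
     (\<forall>U c. openin tau U \<longrightarrow> (\<forall>\<^sub>F n in sequentially. time_avg T (indicator U) n y \<le> c) \<longrightarrow> measure M U \<le> c) \<and>
     (\<forall>A e. A \<in> sets borel \<longrightarrow> 0 < e \<longrightarrow> (\<exists>U. openin tau U \<and> A \<subseteq> U \<and> measure M U < measure M A + e))"

lemma orbit_measureD:
  assumes "orbit_measure y M"
  shows "sets M = sets borel" "invariant_prob M T"
    "\<And>K c. compactin tau K \<Longrightarrow> \<forall>\<^sub>F n in sequentially. c \<le> time_avg T (indicator K) n y \<Longrightarrow> c \<le> measure M K"
    "\<And>U c. openin tau U \<Longrightarrow> \<forall>\<^sub>F n in sequentially. time_avg T (indicator U) n y \<le> c \<Longrightarrow> measure M U \<le> c"
    "\<And>A e. A \<in> sets borel \<Longrightarrow> 0 < e \<Longrightarrow> \<exists>U. openin tau U \<and> A \<subseteq> U \<and> measure M U < measure M A + e"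
  using assms unfolding orbit_measure_def by simp_all

lemma ex_orbit_measure:
  assumes tight: "\<And>e. e > 0 \<Longrightarrow> \<exists>K. compactin tau K \<and> (\<forall>\<^sub>F n in sequentially. 1 - e \<le> time_avg T (indicator K) n y)"
  shows "\<exists>M. orbit_measure y M"
proof -
  obtain L where "orbit_mean T y L"
    using ex_orbit_mean[of T y] by blast
  then have L: "\<And>A. 0 \<le> L A" "\<And>A B. A \<inter> B = {} \<Longrightarrow> L (A \<union> B) = L A + L B" "\<And>A. L (T -` A) = L A"
    and L_ge: "\<And>A c. \<forall>\<^sub>F n in sequentially. c \<le> time_avg T (indicator A) n y \<Longrightarrow> c \<le> L A"
    and L_le: "\<And>A c. \<forall>\<^sub>F n in sequentially. time_avg T (indicator A) n y \<le> c \<Longrightarrow> L A \<le> c"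
    unfolding orbit_mean_def by blast+
  interpret compact_content tau L
    by unfold_locales (use topspace_tau Hausdorff_tau L in auto)
  \<comment> \<open>Compact subsets of \<open>U\<close> and of its preimage correspond under
    \<open>T\<close>, by preimages one way and images the other, and \<open>L\<close> takes equal
    values on corresponding sets.\<close>
  have inner_T: "inner (T -` U) = inner U" for U
  proof (rule antisym)
    show "inner (T -` U) \<le> inner U"
      unfolding inner_def[of "T -` U"]
    proof (rule SUP_least)
      fix K assume K: "K \<in> {K. compactin tau K \<and> K \<subseteq> T -` U}"
      have "L K = L (T ` K)"
        using L(3)[of "T ` K"] bij_T by (simp add: bij_is_inj inj_vimage_image_eq)
      then show "ennreal (L K) \<le> inner U"
        using K le_inner[of "T ` K" U] compactin_image_T by auto
    qed
    show "inner U \<le> inner (T -` U)"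
      unfolding inner_def[of U]
    proof (rule SUP_least)
      fix K assume K: "K \<in> {K. compactin tau K \<and> K \<subseteq> U}"
      then show "ennreal (L K) \<le> inner (T -` U)"
        using le_inner[of "T -` K" "T -` U"] compactin_vimage_T by (auto simp: L(3))
    qed
  qed
  have outer_T: "outer (T -` A) = outer A" for A
  proof (rule antisym)
    show "outer (T -` A) \<le> outer A"
      unfolding outer_def[of A]
    proof (rule INF_greatest)
      fix U assume U: "U \<in> {U. openin tau U \<and> A \<subseteq> U}"
      then have "outer (T -` A) \<le> inner (T -` U)"
        using openin_vimage_T by (intro outer_le) auto
      then show "outer (T -` A) \<le> inner U"
        by (simp add: inner_T)
    qed
    \<comment> \<open>Images of \<open>tau\<close>-open sets serve as neighbourhoods of
      \<open>A\<close> here; this uses that the inverse of \<open>T\<close> is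
      \<open>tau\<close>-continuous.\<close>
    show "outer A \<le> outer (T -` A)"
      unfolding outer_def[of "T -` A"]
    proof (rule INF_greatest)
      fix U assume U: "U \<in> {U. openin tau U \<and> T -` A \<subseteq> U}"
      have "A \<subseteq> T ` U"
        using U bij_T by (metis (lifting) bij_is_surj image_mono mem_Collect_eq surj_image_vimage_eq)
      then have "outer A \<le> inner (T ` U)"
        using U openin_image_T by (intro outer_le) auto
      also have "\<dots> = inner U"
        using inner_T[of "T ` U"] bij_T by (simp add: bij_is_inj inj_vimage_image_eq)
      finally show "outer A \<le> inner U" .
    qed
  qed
  define M where "M = measure_of UNIV (sets (borel :: 'a measure)) outer"
  have sets_M: "sets M = sets borel" and space_M: "space M = UNIV"
    using sets.sigma_sets_eq[of "borel :: 'a measure"] by (simp_all add: M_def)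
  have "sigma_algebra UNIV (lambda_system UNIV (Pow UNIV) outer)"
    using measure_space_lambda_system by (simp add: measure_space_def)
  then have "sets borel \<subseteq> lambda_system UNIV (Pow UNIV) outer"
    by (rule borel_subset_of_openin) (rule openin_in_lambda_system)
  then have ms: "measure_space UNIV (sets (borel :: 'a measure)) outer"
    using measure_down[OF measure_space_lambda_system] sets.sigma_algebra_axioms[of "borel :: 'a measure"] by simp
  have eM: "emeasure M A = outer A" if "A \<in> sets borel" for A
    unfolding M_def using ms that by (intro emeasure_measure_of_sigma) (auto simp: measure_space_def)
  have fin: "emeasure M UNIV \<le> 1"
  proof -
    have "L UNIV \<le> 1"
      by (intro L_le always_eventually allI time_avg_indicator_bounds(2))
    then have "inner UNIV \<le> 1"
      using inner_le[of UNIV] by (metis dual_order.trans ennreal_1 ennreal_leI)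
    moreover have "openin tau UNIV"
      using openin_topspace[of tau] by (simp add: topspace_tau)
    ultimately show ?thesis
      by (simp add: eM outer_open)
  qed
  have fm: "finite_measure M"
    by (rule finite_measureI) (use fin in \<open>auto simp: space_M top_unique\<close>)
  interpret fm: finite_measure M
    by (rule fm)
  have M_ge: "c \<le> measure M K" if "compactin tau K" "\<forall>\<^sub>F n in sequentially. c \<le> time_avg T (indicator K) n y" for K c
  proof -
    have "ennreal (L K) \<le> emeasure M K"
      using outer_compact[OF that(1)] compactin_borel[OF that(1)] by (simp add: eM)
    then have "L K \<le> measure M K"
      by (simp add: fm.emeasure_eq_measure)
    then show ?thesis
      using L_ge[OF that(2)] by simp
  qed
  have M_le: "measure M U \<le> c" if "openin tau U" "\<forall>\<^sub>F n in sequentially. time_avg T (indicator U) n y \<le> c" for U c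
  proof -
    have "emeasure M U \<le> ennreal (L U)"
      using inner_le[of U] that(1) by (simp add: eM openin_borel outer_open)
    then have "measure M U \<le> L U"
      by (simp add: fm.emeasure_eq_measure L(1))
    then show ?thesis
      using L_le[OF that(2)] by simp
  qed
  have reg: "\<exists>U. openin tau U \<and> A \<subseteq> U \<and> measure M U < measure M A + e" if A: "A \<in> sets borel" "0 < e" for A e
  proof -
    obtain U where U: "openin tau U" "A \<subseteq> U" "inner U < outer A + ennreal e"
      using outer_close[of "ennreal e" A] A by auto
    then have "emeasure M U < emeasure M A + ennreal e"
      using A by (simp add: eM openin_borel outer_open)
    then have "measure M U < measure M A + e"
      using A by (simp add: fm.emeasure_eq_measure ennreal_plus[symmetric] ennreal_less_iff del: ennreal_plus)
    then show ?thesis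
      using U by blast
  qed
  \<comment> \<open>Total mass at most one is immediate from the frequencies; tightness supplies the
    reverse inequality.\<close>
  have "1 \<le> measure M UNIV + e" if e: "e > 0" for e
  proof -
    obtain K where K: "compactin tau K" "\<forall>\<^sub>F n in sequentially. 1 - e \<le> time_avg T (indicator K) n y"
      using tight[OF e] by blast
    have "measure M K \<le> measure M UNIV"
      using fm.bounded_measure[of K] by (simp add: space_M)
    then show ?thesis
      using M_ge[OF K] by linarith
  qed
  then have "1 \<le> measure M UNIV"
    by (rule field_le_epsilon)
  then have "emeasure M (space M) = 1"
    using fin by (simp add: space_M fm.emeasure_eq_measure)
  then have "prob_space M"
    by (rule prob_spaceI)
  moreover have Tm: "T \<in> measurable M M"
    using T_borel by (simp cong: measurable_cong_sets add: sets_M)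
  moreover have "distr M M T = M"
  proof (rule measure_eqI)
    fix A assume "A \<in> sets (distr M M T)"
    then have A: "A \<in> sets borel"
      by (simp add: sets_M)
    have "T -` A \<in> sets borel"
      using measurable_sets[OF T_borel A] by simp
    then show "emeasure (distr M M T) A = emeasure M A"
      using A Tm by (subst emeasure_distr) (auto simp: sets_M space_M eM outer_T)
  qed simp
  ultimately have "invariant_prob M T"
    by (simp add: invariant_prob_def invariant_prob_axioms_def)
  then show ?thesis
    unfolding orbit_measure_def using sets_M M_ge M_le reg by (intro exI[of _ M] conjI allI impI)
qed

end

section \<open>The equivalence\<close>

definition entry_within :: "('a \<Rightarrow> 'a) \<Rightarrow> 'a set \<Rightarrow> nat \<Rightarrow> 'a set" where
  "entry_within T V N = (\<Union>r\<le>N. (T ^^ r) -` V)"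

lemma entry_within_mono: "U \<subseteq> V \<Longrightarrow> m \<le> n \<Longrightarrow> entry_within T U m \<subseteq> entry_within T V n"
  unfolding entry_within_def by fastforce

lemma incseq_entry_within: "incseq (entry_within T V)"
  by (simp add: incseq_def entry_within_mono)

lemma UN_entry_within: "(\<Union>N. entry_within T V N) = (\<Union>r. (T ^^ r) -` V)"
  unfolding entry_within_def by fastforce

text \<open>A positive integer \<open>Suc k\<close> lies in one of the shifted sets exactly when the
  orbit enters \<open>V\<close> within \<open>N\<close> steps after time \<open>Suc k\<close>.
  Densities count from \<open>1\<close> while averages start at time \<open>0\<close>, hence the
  base point \<open>T x\<close> on the right.\<close>

lemma lower_dens_return_times:
  "lower_dens (\<Union>r\<in>{0..N}. shift_set (return_times T x V) r) =
    liminf (\<lambda>n. ereal (time_avg T (indicator (entry_within T V N)) n (T x)))"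
proof -
  have "real (card ((\<Union>r\<in>{0..N}. shift_set (return_times T x V) r) \<inter> {1..int n})) =
      (\<Sum>k<n. indicator (entry_within T V N) ((T ^^ k) (T x)))" for n
  proof -
    have "(\<Union>r\<in>{0..N}. shift_set (return_times T x V) r) \<inter> {1..int n} =
        (\<lambda>k. int (Suc k)) ` {k \<in> {..<n}. (T ^^ k) (T x) \<in> entry_within T V N}" (is "?L = ?R")
    proof (intro set_eqI iffI)
      fix z assume "z \<in> ?L"
      then obtain r m where rm: "r \<le> N" "m \<ge> 1" "(T ^^ m) x \<in> V" "z = int m - int r" "1 \<le> z" "z \<le> int n"
        by (auto simp: shift_set_def return_times_def)
      \<comment> \<open>The time along the orbit of \<open>T x\<close> that corresponds to the
        integer \<open>z\<close>.\<close>
      define k where "k = m - r - 1"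
      have k: "m = r + Suc k" "z = int (Suc k)" "k < n"
        using rm by (auto simp: k_def)
      have "(T ^^ m) x = (T ^^ r) ((T ^^ k) (T x))"
        by (simp only: k funpow_add comp_apply funpow_Suc_right)
      then show "z \<in> ?R"
        using rm k by (auto simp: entry_within_def)
    next
      fix z assume "z \<in> ?R"
      then obtain k r where kr: "k < n" "z = int (Suc k)" "r \<le> N" "(T ^^ r) ((T ^^ k) (T x)) \<in> V"
        by (auto simp: entry_within_def)
      have "(T ^^ r) ((T ^^ k) (T x)) = (T ^^ (r + Suc k)) x"
        by (simp only: funpow_add comp_apply funpow_Suc_right)
      then have "int (r + Suc k) \<in> return_times T x V"
        using kr unfolding return_times_def by (intro CollectI exI[of _ "r + Suc k"]) auto
      moreover have "z = int (r + Suc k) - int r"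
        using kr by simp
      ultimately have "z \<in> shift_set (return_times T x V) r"
        unfolding shift_set_def by blast
      then show "z \<in> ?L"
        using kr by auto
    qed
    then have "card ?L = card {k \<in> {..<n}. (T ^^ k) (T x) \<in> entry_within T V N}"
      by (simp add: card_image inj_on_def)
    then show ?thesis
      by (simp add: indicator_def sum.If_cases Int_def)
  qed
  then show ?thesis
    by (simp add: lower_dens_def time_avg_def)
qed

section \<open>Entry sets, and from an ergodic measure to a generic point\<close>

context compactly_based_system
begin

lemma funpow_borel [measurable]: "(T ^^ k) \<in> borel_measurable borel"
proof (induction k)
  case (Suc k)
  show ?case
    using measurable_comp[OF Suc T_borel] by simp
qed (simp add: id_def)

lemma vimage_funpow_borel: "V \<in> sets borel \<Longrightarrow> (T ^^ k) -` V \<in> sets borel"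
  using measurable_sets[OF funpow_borel, of V k] by simp

lemma entry_within_borel: "V \<in> sets borel \<Longrightarrow> entry_within T V N \<in> sets borel"
  unfolding entry_within_def by (intro sets.finite_UN vimage_funpow_borel) auto

lemma compactin_entry_within: "compactin tau K \<Longrightarrow> compactin tau (entry_within T K N)"
  unfolding entry_within_def by (intro compactin_Union) (auto intro: compactin_vimage_funpow)

text \<open>The union \<open>A\<close> is only known to contain its own preimage. The intersection
  of the decreasing preimages \<open>B n\<close> is truly invariant and, by invariance of
  \<open>M\<close>, has the same measure as \<open>A\<close>, which is positive because
  \<open>A\<close> contains \<open>V\<close>.\<close>

lemma measure_entry_eq_1:
  assumes M: "ergodic_borel_prob T M" "full_support M" and V: "open V" "V \<noteq> {}"
  shows "measure M (\<Union>r. (T ^^ r) -` V) = 1"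
proof -
  have sets_M [simp]: "sets M = sets borel"
    using M by (simp add: ergodic_borel_prob_def)
  have space_M [simp]: "space M = UNIV"
    using sets_eq_imp_space_eq[OF sets_M] by simp
  interpret invariant_prob M T
    using M by (auto simp: ergodic_borel_prob_def invariant_prob_def invariant_prob_axioms_def)
  define A where "A = (\<Union>r. (T ^^ r) -` V)"
  have A: "A \<in> sets borel"
    unfolding A_def using V by (intro sets.countable_UN image_subsetI vimage_funpow_borel) auto
  define B where "B n = (T ^^ n) -` A" for n
  have Bs: "B n \<in> sets borel" for n
    unfolding B_def by (rule vimage_funpow_borel[OF A])
  have B_eq: "B n = (\<Union>r\<in>{n..}. (T ^^ r) -` V)" for n
  proof (intro set_eqI iffI)
    fix x assume "x \<in> B n"
    then obtain r where "(T ^^ (r + n)) x \<in> V"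
      by (auto simp: B_def A_def funpow_add)
    then show "x \<in> (\<Union>r\<in>{n..}. (T ^^ r) -` V)"
      by (intro UN_I[of "r + n"]) auto
  next
    fix x assume "x \<in> (\<Union>r\<in>{n..}. (T ^^ r) -` V)"
    then obtain r where r: "n \<le> r" "(T ^^ r) x \<in> V"
      by auto
    then have "(T ^^ (r - n)) ((T ^^ n) x) \<in> V"
      by (metis comp_apply funpow_add le_add_diff_inverse2)
    then show "x \<in> B n"
      by (auto simp: B_def A_def)
  qed
  have dec: "decseq B"
    unfolding decseq_def B_eq by (intro allI impI UN_mono) auto
  have "measure M (B n) = measure M A" for n
    unfolding B_def using measure_vimage_funpow[of A n] A by simp
  then have "(\<lambda>n. measure M A) \<longlonglongrightarrow> measure M (\<Inter>n. B n)"
    using finite_Lim_measure_decseq[of B] dec Bs by auto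
  then have eq: "measure M (\<Inter>n. B n) = measure M A"
    by (simp add: LIMSEQ_const_iff)
  have "T -` (\<Inter>n. B n) = (\<Inter>n. B (Suc n))"
    by (auto simp: B_def funpow_swap1)
  also have "\<dots> = (\<Inter>n. B n)"
    using dec by (auto simp: decseq_def) (meson Suc_n_not_le_n in_mono nat_le_linear)
  finally have "measure M (\<Inter>n. B n) = 0 \<or> measure M (\<Inter>n. B n) = 1"
    using M Bs by (auto simp: ergodic_borel_prob_def)
  moreover have "measure M A > 0"
  proof -
    have "emeasure M V > 0"
      using M V by (simp add: full_support_def)
    then have "measure M V > 0"
      by (simp add: emeasure_eq_measure)
    moreover have "V \<subseteq> A"
      unfolding A_def by (intro subsetI UN_I[of 0]) auto
    then have "measure M V \<le> measure M A"
      using A by (intro finite_measure_mono) auto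
    ultimately show ?thesis
      by simp
  qed
  ultimately show ?thesis
    using eq by (auto simp: A_def)
qed

text \<open>Only countably many almost sure conditions are imposed, one for each nonempty basic open
  set and each \<open>N\<close>, so a common generic point \<open>y\<close> exists.\<close>

lemma ex_point_of_ergodic:
  assumes M: "ergodic_borel_prob T M" "full_support M"
  shows "\<exists>x0. \<forall>V. open V \<and> V \<noteq> {} \<longrightarrow>
    (\<lambda>N. lower_dens (\<Union>r\<in>{0..N}. shift_set (return_times T x0 V) r)) \<longlonglongrightarrow> 1"
proof -
  have sets_M [simp]: "sets M = sets borel"
    using M by (simp add: ergodic_borel_prob_def)
  interpret invariant_prob M T
    using M by (auto simp: ergodic_borel_prob_def invariant_prob_def invariant_prob_axioms_def)
  obtain \<B> :: "'a set set" where \<B>: "countable \<B>" "\<And>C. C \<in> \<B> \<Longrightarrow> open C"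
    "\<And>S. open S \<Longrightarrow> \<exists>U. U \<subseteq> \<B> \<and> S = \<Union>U"
    by (metis univ_second_countable)
  have "AE y in M. \<forall>B\<in>\<B> - {{}}. (\<forall>e>0. \<exists>N. 1 - e < freq (entry_within T B N) y) \<and>
      (\<forall>N. (\<lambda>n. time_avg T (indicator (entry_within T B N)) n y) \<longlonglongrightarrow> freq (entry_within T B N) y)"
  proof (subst AE_ball_countable)
    show "\<forall>B\<in>\<B> - {{}}. AE y in M. (\<forall>e>0. \<exists>N. 1 - e < freq (entry_within T B N) y) \<and>
      (\<forall>N. (\<lambda>n. time_avg T (indicator (entry_within T B N)) n y) \<longlonglongrightarrow> freq (entry_within T B N) y)"
    proof
      fix B assume "B \<in> \<B> - {{}}"
      then have B: "open B" "B \<noteq> {}"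
        using \<B> by auto
      have W: "entry_within T B N \<in> sets M" for N
        using entry_within_borel B by simp
      have "AE y in M. \<forall>e>0. \<exists>N. 1 - e < freq (entry_within T B N) y"
        by (rule AE_freq_incseq[OF W incseq_entry_within])
          (simp add: UN_entry_within measure_entry_eq_1[OF M B])
      moreover have "AE y in M. \<forall>N. (\<lambda>n. time_avg T (indicator (entry_within T B N)) n y) \<longlonglongrightarrow> freq (entry_within T B N) y"
        unfolding AE_all_countable using AE_tendsto_freq[OF W] by blast
      ultimately show "AE y in M. (\<forall>e>0. \<exists>N. 1 - e < freq (entry_within T B N) y) \<and>
        (\<forall>N. (\<lambda>n. time_avg T (indicator (entry_within T B N)) n y) \<longlonglongrightarrow> freq (entry_within T B N) y)"
        by (rule AE_conjI)
    qed
  qed (use \<B> in auto)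
  then have "\<exists>y. \<forall>B\<in>\<B> - {{}}. (\<forall>e>0. \<exists>N. 1 - e < freq (entry_within T B N) y) \<and>
      (\<forall>N. (\<lambda>n. time_avg T (indicator (entry_within T B N)) n y) \<longlonglongrightarrow> freq (entry_within T B N) y)"
    by (rule eventually_happens'[OF ae_filter_bot])
  then obtain y where Y: "\<forall>B\<in>\<B> - {{}}. (\<forall>e>0. \<exists>N. 1 - e < freq (entry_within T B N) y) \<and>
      (\<forall>N. (\<lambda>n. time_avg T (indicator (entry_within T B N)) n y) \<longlonglongrightarrow> freq (entry_within T B N) y)" ..
  note y = Y[THEN bspec, THEN conjunct1, rule_format] Y[THEN bspec, THEN conjunct2, rule_format]
  \<comment> \<open>The densities at \<open>x0\<close> are averages along the orbit of
    \<open>T x0\<close>, so a preimage of the generic point is taken.\<close>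
  obtain x0 where x0: "T x0 = y"
    using bij_T by (metis bij_pointE)
  show ?thesis
  proof (intro exI[of _ x0] allI impI)
    fix V :: "'a set" assume V: "open V \<and> V \<noteq> {}"
    then obtain \<U> where U: "\<U> \<subseteq> \<B>" "V = \<Union>\<U>"
      using \<B>(3) by blast
    \<comment> \<open>Entry sets grow with the target, so a basic set inside \<open>V\<close> gives
      the lower bound for \<open>V\<close>.\<close>
    then obtain B where B: "B \<in> \<B> - {{}}" "B \<subseteq> V"
      using V by blast
    let ?f = "\<lambda>N. liminf (\<lambda>n. ereal (time_avg T (indicator (entry_within T V N)) n y))"
    have "?f \<longlonglongrightarrow> 1"
    proof (rule order_tendstoI)
      fix a :: ereal assume "a < 1"
      then obtain r where r: "a < ereal r" "ereal r < 1"
        using ereal_dense2 by blast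
      then obtain N0 where N0: "r < freq (entry_within T B N0) y"
        using y(1)[OF B(1), of "1 - r"] by auto
      have "a < ?f N" if "N \<ge> N0" for N
      proof -
        have "ereal (freq (entry_within T B N0) y) = liminf (\<lambda>n. ereal (time_avg T (indicator (entry_within T B N0)) n y))"
          using y(2)[OF B(1), of N0] by (intro lim_imp_Liminf[symmetric]) auto
        also have "\<dots> \<le> ?f N"
          using B that by (intro Liminf_mono always_eventually allI) (simp add: time_avg_indicator_mono entry_within_mono)
        finally show ?thesis
          using N0 r by (metis less_ereal.simps(1) order_less_le_trans order_less_trans)
      qed
      then show "\<forall>\<^sub>F N in sequentially. a < ?f N"
        by (rule eventually_sequentiallyI)
    next
      fix a :: ereal assume a: "a > 1"
      have "?f N \<le> 1" for N
      proof -
        have "?f N \<le> limsup (\<lambda>n. ereal (time_avg T (indicator (entry_within T V N)) n y))"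
          by (rule Liminf_le_Limsup) simp
        also have "\<dots> \<le> 1"
          by (rule Limsup_bounded) (simp add: time_avg_indicator_bounds)
        finally show ?thesis .
      qed
      then show "\<forall>\<^sub>F N in sequentially. ?f N < a"
        using a by (intro always_eventually allI) (rule le_less_trans)
    qed
    then show "(\<lambda>N. lower_dens (\<Union>r\<in>{0..N}. shift_set (return_times T x0 V) r)) \<longlonglongrightarrow> 1"
      by (simp add: lower_dens_return_times x0)
  qed
qed

text \<open>Two families with different roles: the members of \<open>\<C>\<close> are the sets to be
  visited, small enough to detect full support, while \<open>\<K>\<close> is a countable
  intersection-stable generator closed under preimages. The pair correlations in the variance of a
  time average thus stay inside \<open>\<K>\<close>.\<close>

definition compact_generator :: "'a set set \<Rightarrow> 'a set set \<Rightarrow> bool" where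
  "compact_generator \<C> \<K> \<longleftrightarrow> countable \<K> \<and> \<C> \<subseteq> \<K> \<and> (\<forall>K\<in>\<C>. interior K \<noteq> {}) \<and>
     (\<forall>V. open V \<and> V \<noteq> {} \<longrightarrow> (\<exists>K\<in>\<C>. K \<subseteq> V)) \<and> (\<forall>K\<in>\<K>. compactin tau K) \<and> Int_stable \<K> \<and>
     (\<forall>K\<in>\<K>. \<forall>k. (T ^^ k) -` K \<in> \<K>) \<and> sets borel = sigma_sets UNIV \<K>"

lemma compact_generatorD:
  assumes "compact_generator \<C> \<K>"
  shows "countable \<K>" "\<C> \<subseteq> \<K>" "\<And>K. K \<in> \<C> \<Longrightarrow> interior K \<noteq> {}"
    "\<And>V. open V \<Longrightarrow> V \<noteq> {} \<Longrightarrow> \<exists>K\<in>\<C>. K \<subseteq> V" "\<And>K. K \<in> \<K> \<Longrightarrow> compactin tau K" "Int_stable \<K>"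
    "\<And>K k. K \<in> \<K> \<Longrightarrow> (T ^^ k) -` K \<in> \<K>" "sets borel = sigma_sets UNIV \<K>"
  using assms unfolding compact_generator_def by simp_all

lemma ex_compact_generator: "\<exists>\<C> \<K>. compact_generator \<C> \<K>"
proof -
  obtain \<B> :: "'a set set" where \<B>: "countable \<B>" "\<And>C. C \<in> \<B> \<Longrightarrow> open C"
    "\<And>S. open S \<Longrightarrow> \<exists>U. U \<subseteq> \<B> \<and> S = \<Union>U"
    by (metis univ_second_countable)
  have "\<exists>C. countable C \<and> (\<forall>K\<in>C. compactin tau K \<and> interior K \<noteq> {}) \<and> \<Union>C = B" if "B \<in> \<B>" for B
    using open_eq_Union_compactin[OF \<B>(2)[OF that]] by metis
  then obtain D where D: "\<And>B. B \<in> \<B> \<Longrightarrow> countable (D B)"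
    "\<And>B K. B \<in> \<B> \<Longrightarrow> K \<in> D B \<Longrightarrow> compactin tau K \<and> interior K \<noteq> {}" "\<And>B. B \<in> \<B> \<Longrightarrow> \<Union>(D B) = B"
    by metis
  define \<C> where "\<C> = (\<Union>B\<in>\<B>. D B)"
  \<comment> \<open>Members of \<open>\<K>\<close> are indexed by finite sets of pairs (time, set).
    Intersections become unions of index sets, preimages become shifts of the times, and
    countability is inherited from the index sets.\<close>
  define I where "I F = (\<Inter>p\<in>F. (T ^^ fst p) -` snd p)" for F :: "(nat \<times> 'a set) set"
  \<comment> \<open>The empty index set is excluded: its intersection is the whole space, which may
    fail to be \<open>tau\<close>-compact.\<close>
  define \<F> where "\<F> = {F. finite F \<and> F \<noteq> {} \<and> F \<subseteq> (UNIV :: nat set) \<times> \<C>}"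
  define \<K> where "\<K> = I ` \<F>"
  have C: "countable \<C>" "\<And>K. K \<in> \<C> \<Longrightarrow> compactin tau K" "\<And>K. K \<in> \<C> \<Longrightarrow> interior K \<noteq> {}"
    using \<B>(1) D by (auto simp: \<C>_def)
  have CK: "\<C> \<subseteq> \<K>"
  proof
    fix K assume "K \<in> \<C>"
    then have "{(0, K)} \<in> \<F>" "I {(0, K)} = K"
      by (auto simp: \<F>_def I_def)
    then show "K \<in> \<K>"
      unfolding \<K>_def by blast
  qed
  have comp: "compactin tau K" if KK: "K \<in> \<K>" for K
  proof -
    obtain F where "F \<in> \<F>" and K: "K = I F"
      using KK unfolding \<K>_def by blast
    then have F: "finite F" "F \<noteq> {}" "F \<subseteq> UNIV \<times> \<C>"
      unfolding \<F>_def by simp_all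
    have comp: "compactin tau ((T ^^ fst p) -` snd p)" if "p \<in> F" for p
      using that F(3) by (intro compactin_vimage_funpow C(2)) auto
    obtain p where "p \<in> F"
      using F(2) by blast
    then show ?thesis
      unfolding K I_def using comp compactin_imp_closedin[OF Hausdorff_tau]
      by (intro closed_compactin_Inter[of tau "(T ^^ fst p) -` snd p"]) auto
  qed
  have countable_K: "countable \<K>"
    unfolding \<K>_def \<F>_def using countable_Collect_finite_subset[of "(UNIV :: nat set) \<times> \<C>"] C(1)
    by (intro countable_image countable_subset[of "{F. finite F \<and> F \<noteq> {} \<and> F \<subseteq> UNIV \<times> \<C>}" "{F. finite F \<and> F \<subseteq> UNIV \<times> \<C>}"]) (auto simp: conj_commute)
  have dense: "\<exists>K\<in>\<C>. K \<subseteq> V" if V: "open V \<and> V \<noteq> {}" for V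
  proof -
    obtain \<U> where U: "\<U> \<subseteq> \<B>" "V = \<Union>\<U>"
      using \<B>(3) V by blast
    then obtain B where B: "B \<in> \<B>" "B \<noteq> {}" "B \<subseteq> V"
      using V by blast
    then obtain K where "K \<in> D B"
      using D(3)[OF B(1)] by blast
    moreover from this have "K \<subseteq> V"
      using D(3)[OF B(1)] B(3) by blast
    ultimately show ?thesis
      using B(1) unfolding \<C>_def by blast
  qed
  have stable: "Int_stable \<K>"
  proof (rule Int_stableI)
    fix a b assume "a \<in> \<K>" "b \<in> \<K>"
    then obtain F G where FG: "F \<in> \<F>" "G \<in> \<F>" "a = I F" "b = I G"
      by (auto simp: \<K>_def)
    then have "F \<union> G \<in> \<F>" "a \<inter> b = I (F \<union> G)"
      by (auto simp: \<F>_def I_def)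
    then show "a \<inter> b \<in> \<K>"
      unfolding \<K>_def by blast
  qed
  have vim: "(T ^^ k) -` K \<in> \<K>" if KK: "K \<in> \<K>" for K k
  proof -
    obtain F where F: "F \<in> \<F>" "K = I F"
      using KK by (auto simp: \<K>_def)
    define G where "G = (\<lambda>p. (fst p + k, snd p)) ` F"
    have "G \<in> \<F>"
      using F(1) by (auto simp: \<F>_def G_def)
    moreover have "(T ^^ k) -` K = I G"
      by (simp add: F(2) I_def G_def funpow_add vimage_INT vimage_comp)
    ultimately show ?thesis
      unfolding \<K>_def by blast
  qed
  have sigma: "sets borel = sigma_sets UNIV \<K>"
  proof
    interpret S: sigma_algebra UNIV "sigma_sets UNIV \<K>"
      by (rule sigma_algebra_sigma_sets) simp
    have "B \<in> sigma_sets UNIV \<K>" if "B \<in> \<B>" for B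
    proof -
      have "\<Union>(D B) \<in> sigma_sets UNIV \<K>"
        using that D(1) CK by (intro S.countable_Union) (auto simp: \<C>_def)
      then show ?thesis
        using D(3) that by simp
    qed
    then have "U \<in> sigma_sets UNIV \<K>" if "open U" for U
      using \<B>(3)[OF that] \<B>(1) by (metis S.countable_Union countable_subset subset_iff)
    then show "sets borel \<subseteq> sigma_sets UNIV \<K>"
      unfolding borel_def using S.sigma_sets_subset[of "Collect open"] by auto
    have "\<K> \<subseteq> sets borel"
      using comp compactin_borel by blast
    then show "sigma_sets UNIV \<K> \<subseteq> sets borel"
      using sets.sigma_sets_subset[of \<K> borel] by simp
  qed
  have "compact_generator \<C> \<K>"
    unfolding compact_generator_def
    by (intro conjI ballI allI impI countable_K CK C(3) dense comp stable vim sigma) simp_all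
  then show ?thesis
    by blast
qed

section \<open>Full support and ergodic components\<close>

lemma measure_UN_entry_eq_1:
  assumes "prob_space M" and sets_M: "sets M = sets borel" and K: "K \<in> sets borel"
    and ge: "\<And>e. e > 0 \<Longrightarrow> \<exists>N. 1 - e \<le> measure M (entry_within T K N)"
  shows "measure M (\<Union>N. entry_within T K N) = 1"
proof -
  interpret prob_space M
    by fact
  have "1 \<le> measure M (\<Union>N. entry_within T K N) + e" if e: "e > 0" for e
  proof -
    obtain N where N: "1 - e \<le> measure M (entry_within T K N)"
      using ge[OF e] by blast
    have "measure M (entry_within T K N) \<le> measure M (\<Union>N. entry_within T K N)"
      by (rule finite_measure_mono) (use entry_within_borel[OF K] sets_M in auto)
    then show ?thesis
      using N by linarith
  qed
  then have "1 \<le> measure M (\<Union>N. entry_within T K N)"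
    by (rule field_le_epsilon)
  then show ?thesis
    using prob_le_1 by (rule antisym[rotated])
qed

text \<open>If some \<open>K\<close> in \<open>\<C>\<close> were null, all its preimages would be
  null by invariance, and so would their union, which has mass one.\<close>

lemma full_support_of_entry:
  assumes "invariant_prob M T" and sets_M: "sets M = sets borel" and gen: "compact_generator \<C> \<K>"
    and full: "\<And>K. K \<in> \<C> \<Longrightarrow> measure M (\<Union>N. entry_within T K N) = 1"
  shows "full_support M"
  unfolding full_support_def
proof (intro allI impI)
  interpret invariant_prob M T
    by fact
  have space_M: "space M = UNIV"
    using sets_eq_imp_space_eq[OF sets_M] by simp
  fix V :: "'a set" assume V: "open V \<and> V \<noteq> {}"
  then obtain K where K: "K \<in> \<C>" "K \<subseteq> V"
    using gen unfolding compact_generator_def by blast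
  then have "compactin tau K"
    using gen unfolding compact_generator_def by blast
  then have Kb: "K \<in> sets M"
    by (simp add: sets_M compactin_borel)
  have "measure M K \<noteq> 0"
  proof
    assume "measure M K = 0"
    then have "measure M ((T ^^ r) -` K) = 0" for r
      using measure_vimage_funpow[OF Kb, of r] by (simp add: space_M)
    then have "(T ^^ r) -` K \<in> null_sets M" for r
      using vimage_funpow_borel[of K r] Kb by (intro null_setsI) (auto simp: emeasure_eq_measure sets_M)
    then have "(\<Union>r. (T ^^ r) -` K) \<in> null_sets M"
      by (intro null_sets_UN)
    then show False
      using full[OF K(1)] by (simp add: UN_entry_within null_sets_def measure_def)
  qed
  then have "0 < emeasure M K"
    by (simp add: emeasure_eq_measure zero_less_measure_iff)
  also have "\<dots> \<le> emeasure M V"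
    using V K by (intro emeasure_mono) (auto simp: sets_M)
  finally show "emeasure M V > 0" .
qed

text \<open>The empirical limit \<open>M'\<close> at an \<open>M\<close>-generic point plays the role of an ergodic component of \<open>M\<close>. Its variance
  of the time averages of a set in the generator is the value at that point of a function whose
  \<open>M\<close>-integral tends to zero.\<close>

lemma ex_ergodic_component:
  assumes M: "orbit_measure y M" and gen: "compact_generator \<C> \<K>"
    and full: "\<And>K. K \<in> \<C> \<Longrightarrow> measure M (\<Union>N. entry_within T K N) = 1"
  shows "\<exists>M'. ergodic_borel_prob T M' \<and> full_support M'"
proof -
  have sets_M [simp]: "sets M = sets borel" and inv_M: "invariant_prob M T"
    and reg: "\<And>A e. A \<in> sets borel \<Longrightarrow> 0 < e \<Longrightarrow> \<exists>U. openin tau U \<and> A \<subseteq> U \<and> measure M U < measure M A + e"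
    by (fact orbit_measureD[OF M])+
  interpret invariant_prob M T
    by (rule inv_M)
  note countable_K = compact_generatorD(1)[OF gen] and CK = compact_generatorD(2)[OF gen]
    and dense = compact_generatorD(4)[OF gen] and comp = compact_generatorD(5)[OF gen]
    and stable = compact_generatorD(6)[OF gen] and vim = compact_generatorD(7)[OF gen]
    and sigma = compact_generatorD(8)[OF gen]
  have Kb: "K \<in> sets M" if "K \<in> \<K>" for K
    using comp[OF that] compactin_borel by simp
  have Eb: "entry_within T K N \<in> sets M" if "K \<in> \<K>" for K N
    using Kb[OF that] entry_within_borel by simp

  \<comment> \<open>A limit measure is bounded from above by frequencies on \<open>tau\<close>-open
    sets only, so each compact \<open>K\<close> is enclosed in open sets whose
    \<open>M\<close>-measures approach that of \<open>K\<close>.\<close>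
  have "\<exists>U. \<forall>n. openin tau (U n) \<and> K \<subseteq> U n \<and> measure M (U n) < measure M K + 1 / real (Suc n)" if "K \<in> \<K>" for K
    using reg[of K] Kb[OF that] by (intro choice allI) simp
  then obtain U where U: "\<And>K n. K \<in> \<K> \<Longrightarrow> openin tau (U K n)" "\<And>K n. K \<in> \<K> \<Longrightarrow> K \<subseteq> U K n"
    "\<And>K n. K \<in> \<K> \<Longrightarrow> measure M (U K n) < measure M K + 1 / real (Suc n)"
    by metis
  have Ub: "U K n \<in> sets M" if "K \<in> \<K>" for K n
    using U(1)[OF that] openin_borel by simp
  have Ulim: "(\<lambda>n. measure M (U K n)) \<longlonglongrightarrow> measure M K" if K: "K \<in> \<K>" for K
  proof (rule tendsto_sandwich)
    show "\<forall>\<^sub>F n in sequentially. measure M K \<le> measure M (U K n)"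
      using U(2)[OF K] Ub[OF K] by (intro always_eventually allI finite_measure_mono)
    show "\<forall>\<^sub>F n in sequentially. measure M (U K n) \<le> measure M K + 1 / real (Suc n)"
      using U(3)[OF K] by (intro always_eventually allI less_imp_le)
    show "(\<lambda>n. measure M K + 1 / real (Suc n)) \<longlonglongrightarrow> measure M K"
      using tendsto_add[OF tendsto_const LIMSEQ_inverse_real_of_nat, of "measure M K"]
      by (simp add: inverse_eq_divide)
  qed simp

  define conv where "conv A x \<longleftrightarrow> (\<lambda>n. time_avg T (indicator A) n x) \<longlonglongrightarrow> freq A x" for A x
  \<comment> \<open>Countably many almost sure conditions: convergence of the relevant averages,
    approximation of \<open>K\<close> from outside in frequency, and nearly full frequency of
    entry.\<close>
  define good where "good x \<longleftrightarrow> (\<forall>K\<in>\<K>. conv K x \<and> (\<forall>n. conv (U K n) x) \<and> (\<forall>N. conv (entry_within T K N) x) \<and>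
      (\<forall>e>0. \<exists>n. freq (U K n) x < freq K x + e)) \<and>
      (\<forall>K\<in>\<C>. \<forall>e>0. \<exists>N. 1 - e < freq (entry_within T K N) x)" for x
  have AE_good: "AE x in M. good x"
  proof -
    have "AE x in M. conv K x \<and> (\<forall>n. conv (U K n) x) \<and> (\<forall>N. conv (entry_within T K N) x) \<and>
      (\<forall>e>0. \<exists>n. freq (U K n) x < freq K x + e)" if K: "K \<in> \<K>" for K
      unfolding conv_def
      by (intro AE_conjI AE_all_countable[THEN iffD2] allI AE_tendsto_freq Kb Ub Eb K AE_freq_approx U Ulim)
    moreover have "AE x in M. \<forall>e>0. \<exists>N. 1 - e < freq (entry_within T K N) x" if K: "K \<in> \<C>" for K
      using K CK full[OF K] by (intro AE_freq_incseq incseq_entry_within Eb) auto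
    ultimately show ?thesis
      unfolding good_def using countable_K countable_subset[OF CK]
      by (intro AE_conjI AE_ball_countable[THEN iffD2] ballI) auto
  qed
  have component: "\<exists>M'. orbit_measure x M' \<and> (\<forall>K\<in>\<K>. measure M' K = freq K x) \<and>
      (\<forall>K\<in>\<C>. measure M' (\<Union>N. entry_within T K N) = 1)" if x: "good x" for x
  proof -
    have evle: "\<forall>\<^sub>F n in sequentially. time_avg T (indicator A) n x \<le> c" if "conv A x" "freq A x < c" for A c
      using order_tendstoD(2)[OF that[unfolded conv_def]] by (rule eventually_mono) simp
    have evge: "\<forall>\<^sub>F n in sequentially. c \<le> time_avg T (indicator A) n x" if "conv A x" "c < freq A x" for A c
      using order_tendstoD(1)[OF that[unfolded conv_def]] by (rule eventually_mono) simp
    have hit: "\<exists>N. \<forall>\<^sub>F n in sequentially. 1 - e \<le> time_avg T (indicator (entry_within T K N)) n x" if K: "K \<in> \<C>" "e > 0" for K e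
    proof -
      obtain N where "1 - e < freq (entry_within T K N) x"
        using x K unfolding good_def by blast
      moreover have "conv (entry_within T K N) x"
        using x K CK unfolding good_def by blast
      ultimately show ?thesis
        using evge by blast
    qed
    \<comment> \<open>Entry sets of a single compact set are \<open>tau\<close>-compact and carry
      nearly all of the orbit, which is the tightness required.\<close>
    obtain K0 where K0: "K0 \<in> \<C>"
      using dense[of UNIV] by auto
    have "\<exists>M'. orbit_measure x M'"
    proof (rule ex_orbit_measure)
      fix e :: real assume "e > 0"
      then obtain N where "\<forall>\<^sub>F n in sequentially. 1 - e \<le> time_avg T (indicator (entry_within T K0 N)) n x"
        using hit[OF K0] by blast
      then show "\<exists>K. compactin tau K \<and> (\<forall>\<^sub>F n in sequentially. 1 - e \<le> time_avg T (indicator K) n x)"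
        using compactin_entry_within comp K0 CK by blast
    qed
    then obtain M' where M': "orbit_measure x M'" ..
    note sets_M' = orbit_measureD(1)[OF M'] and inv' = orbit_measureD(2)[OF M']
      and ge = orbit_measureD(3)[OF M'] and le = orbit_measureD(4)[OF M']
    interpret M': invariant_prob M' T
      by (rule inv')
    have "measure M' K = freq K x" if K: "K \<in> \<K>" for K
    proof (rule antisym)
      show "measure M' K \<le> freq K x"
      proof (rule field_le_epsilon)
        fix e :: real assume "e > 0"
        then obtain n where n: "freq (U K n) x < freq K x + e"
          using x K unfolding good_def by blast
        have "conv (U K n) x"
          using x K unfolding good_def by blast
        then have "measure M' (U K n) \<le> freq K x + e"
          using le[OF U(1)[OF K]] evle n by blast
        moreover have "measure M' K \<le> measure M' (U K n)"
          using U(2)[OF K] Ub[OF K] by (intro M'.finite_measure_mono) (auto simp: sets_M')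
        ultimately show "measure M' K \<le> freq K x + e"
          by simp
      qed
      show "freq K x \<le> measure M' K"
      proof (rule field_le_epsilon)
        fix e :: real assume "e > 0"
        moreover have "conv K x"
          using x K unfolding good_def by blast
        ultimately have "freq K x - e \<le> measure M' K"
          using ge[OF comp[OF K]] evge[of K "freq K x - e"] by simp
        then show "freq K x \<le> measure M' K + e"
          by simp
      qed
    qed
    moreover have "measure M' (\<Union>N. entry_within T K N) = 1" if K: "K \<in> \<C>" for K
    proof (rule measure_UN_entry_eq_1[OF M'.prob_space_axioms sets_M'])
      show "K \<in> sets borel"
        using K CK Kb by auto
      fix e :: real assume "e > 0"
      then obtain N where "\<forall>\<^sub>F n in sequentially. 1 - e \<le> time_avg T (indicator (entry_within T K N)) n x"
        using hit[OF K] by blast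
      then have "1 - e \<le> measure M' (entry_within T K N)"
        using K CK by (intro ge compactin_entry_within comp) auto
      then show "\<exists>N. 1 - e \<le> measure M' (entry_within T K N)" ..
    qed
    ultimately show ?thesis
      using M' by blast
  qed

  \<comment> \<open>The variance of the time average under the component at \<open>x\<close>,
    written through \<open>freq\<close> alone. It can thus be integrated over \<open>x\<close>
    without a measurable choice of components.\<close>
  define Q where "Q K n x = (\<Sum>i<n. \<Sum>j<n. freq ((T ^^ i) -` K \<inter> (T ^^ j) -` K) x) / (real n)\<^sup>2 - (freq K x)\<^sup>2" for K n x
  have KK: "(T ^^ i) -` K \<inter> (T ^^ j) -` K \<in> \<K>" if "K \<in> \<K>" for K i j
    using Int_stableD[OF stable vim[OF that] vim[OF that]] .
  have variance_Q: "prob_space.variance M' (time_avg T (indicator K) n) = Q K n x"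
    if M': "orbit_measure x M'" "\<And>K. K \<in> \<K> \<Longrightarrow> measure M' K = freq K x" and K: "K \<in> \<K>" "n > 0" for M' x K n
  proof -
    note sets_M' = orbit_measureD(1)[OF M'(1)]
    interpret M': invariant_prob M' T
      by (rule orbit_measureD(2)[OF M'(1)])
    have Kb': "K \<in> sets M'"
      using Kb[OF K(1)] sets_M' by simp
    have "space M' = UNIV"
      using sets_eq_imp_space_eq[OF sets_M'] by simp
    moreover have mean: "M'.expectation (time_avg T (indicator K) n) = freq K x"
      by (simp add: M'.integral_time_avg_indicator[OF Kb' K(2)] M'(2) K(1))
    ultimately show ?thesis
      using M'.variance_eq[OF M'.integrable_time_avg_indicator[OF Kb', of n]] unfolding mean
      by (simp add: Q_def M'.integral_time_avg_indicator_square[OF Kb'] M'(2) K KK)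
  qed
  \<comment> \<open>The index \<open>Suc n\<close> avoids \<open>0\<close>, where division by zero
    would leave \<open>Q\<close> equal to minus the square of \<open>freq K x\<close>.\<close>
  have AE_Q: "AE x in M. \<forall>K\<in>\<K>. \<forall>e>0. \<exists>n. Q K (Suc n) x < e"
  proof (subst AE_ball_countable[OF countable_K], rule ballI)
    fix K assume K: "K \<in> \<K>"
    show "AE x in M. \<forall>e>0. \<exists>n. Q K (Suc n) x < e"
    proof (rule AE_ex_less_of_integral_tendsto_0)
      have int_sum: "integrable M (\<lambda>x. (\<Sum>i<n. \<Sum>j<n. freq ((T ^^ i) -` K \<inter> (T ^^ j) -` K) x) / (real n)\<^sup>2)" for n
        by (intro integrable_divide_zero Bochner_Integration.integrable_sum integrable_freq Kb KK K)
      have int_sq: "integrable M (\<lambda>x. (freq K x)\<^sup>2)"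
      proof (rule integrable_const_bound[of _ 1])
        show "AE x in M. norm ((freq K x)\<^sup>2) \<le> 1"
          using AE_freq_bounds[OF Kb[OF K]] by eventually_elim (simp add: power_le_one)
      qed (intro borel_measurable_power freq_measurable Kb K)
      show "integrable M (Q K (Suc n))" for n
        unfolding Q_def[abs_def] by (intro Bochner_Integration.integrable_diff int_sum int_sq)
      \<comment> \<open>At good points \<open>Q\<close> is an actual variance, hence
        nonnegative.\<close>
      show "AE x in M. 0 \<le> Q K (Suc n) x" for n
        using AE_good
      proof eventually_elim
        case (elim x)
        obtain M' where M': "orbit_measure x M'" "\<And>K. K \<in> \<K> \<Longrightarrow> measure M' K = freq K x"
          using component[OF elim] by blast
        have "prob_space M'"
          using orbit_measureD(2)[OF M'(1)] by (simp add: invariant_prob_def)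
        then show ?case
          using prob_space.variance_positive[of M'] variance_Q[OF M' K, of "Suc n"] by (metis zero_less_Suc)
      qed
      have space_M: "space M = UNIV"
        using sets_eq_imp_space_eq[OF sets_M] by simp
      \<comment> \<open>Integrating frequencies returns the \<open>M\<close>-measures of the
        correlations, so the first term becomes the second moment of the time averages under
        \<open>M\<close>. By dominated convergence it tends to the integral of the squared
        frequency, which cancels the second term.\<close>
      have "(\<integral>x. Q K (Suc n) x \<partial>M) = (\<integral>x. (time_avg T (indicator K) (Suc n) x)\<^sup>2 \<partial>M) - (\<integral>x. (freq K x)\<^sup>2 \<partial>M)" for n
      proof -
        have S: "(\<integral>x. (\<Sum>i<n. \<Sum>j<n. freq ((T ^^ i) -` K \<inter> (T ^^ j) -` K) x) / (real n)\<^sup>2 \<partial>M) =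
            (\<integral>x. (time_avg T (indicator K) n x)\<^sup>2 \<partial>M)" for n
        proof -
          let ?E = "\<lambda>i j. (T ^^ i) -` K \<inter> (T ^^ j) -` K"
          have int_E: "integrable M (freq (?E i j))" for i j
            by (intro integrable_freq Kb KK K)
          have "(\<integral>x. (\<Sum>i<n. \<Sum>j<n. freq (?E i j) x) \<partial>M) = (\<Sum>i<n. \<integral>x. (\<Sum>j<n. freq (?E i j) x) \<partial>M)"
            by (rule Bochner_Integration.integral_sum) (intro Bochner_Integration.integrable_sum int_E)
          also have "\<dots> = (\<Sum>i<n. \<Sum>j<n. \<integral>x. freq (?E i j) x \<partial>M)"
            by (intro sum.cong refl Bochner_Integration.integral_sum int_E)
          also have "\<dots> = (\<Sum>i<n. \<Sum>j<n. measure M (?E i j))"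
            by (intro sum.cong refl integral_freq Kb KK K)
          finally show ?thesis
            by (simp add: integral_time_avg_indicator_square[OF Kb[OF K]] space_M)
        qed
        show ?thesis
          by (simp only: Q_def Bochner_Integration.integral_diff[OF int_sum int_sq] S)
      qed
      moreover have "(\<lambda>n. (\<integral>x. (time_avg T (indicator K) (Suc n) x)\<^sup>2 \<partial>M) - (\<integral>x. (freq K x)\<^sup>2 \<partial>M))
          \<longlonglongrightarrow> (\<integral>x. (freq K x)\<^sup>2 \<partial>M) - (\<integral>x. (freq K x)\<^sup>2 \<partial>M)"
        by (intro tendsto_diff tendsto_const LIMSEQ_Suc integral_time_avg_indicator_square_tendsto Kb K)
      ultimately show "(\<lambda>n. \<integral>x. Q K (Suc n) x \<partial>M) \<longlonglongrightarrow> 0"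
        by simp
    qed
  qed
  have "AE x in M. good x \<and> (\<forall>K\<in>\<K>. \<forall>e>0. \<exists>n. Q K (Suc n) x < e)"
    using AE_good AE_Q by (rule AE_conjI)
  then have "\<exists>x. good x \<and> (\<forall>K\<in>\<K>. \<forall>e>0. \<exists>n. Q K (Suc n) x < e)"
    by (rule eventually_happens'[OF ae_filter_bot])
  then obtain x where x: "good x" "\<And>K e. K \<in> \<K> \<Longrightarrow> e > 0 \<Longrightarrow> \<exists>n. Q K (Suc n) x < e"
    by blast
  obtain M' where M': "orbit_measure x M'" "\<And>K. K \<in> \<K> \<Longrightarrow> measure M' K = freq K x"
    and full': "\<And>K. K \<in> \<C> \<Longrightarrow> measure M' (\<Union>N. entry_within T K N) = 1"
    using component[OF x(1)] by blast
  note sets_M' = orbit_measureD(1)[OF M'(1)] and inv' = orbit_measureD(2)[OF M'(1)]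
  interpret M': invariant_prob M' T
    by (rule inv')
  have space_M': "space M' = UNIV"
    using sets_eq_imp_space_eq[OF sets_M'] by simp
  have "measure M' A = 0 \<or> measure M' A = 1" if A: "A \<in> sets M'" "T -` A \<inter> space M' = A" for A
  proof (rule M'.zero_one_of_variance[OF _ stable _ _ A])
    show "\<K> \<subseteq> sets M'"
      using Kb by (auto simp: sets_M')
    show "sets M' = sigma_sets (space M') \<K>"
      by (simp add: sets_M' space_M' sigma)
    fix K and e :: real assume K: "K \<in> \<K>" "e > 0"
    then obtain n where "Q K (Suc n) x < e"
      using x(2) by blast
    then show "\<exists>n>0. M'.variance (time_avg T (indicator K) n) < e"
      using variance_Q[OF M' K(1), of "Suc n"] by (intro exI[of _ "Suc n"]) simp
  qed
  then have "ergodic_borel_prob T M'"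
    unfolding ergodic_borel_prob_def
    using M'.prob_space_axioms sets_M' M'.T_measurable M'.T_invariant by blast
  moreover have "full_support M'"
    by (rule full_support_of_entry[OF inv' sets_M' gen full'])
  ultimately show ?thesis
    by blast
qed

section \<open>From a point to an ergodic measure\<close>

lemma ex_ergodic_of_point:
  assumes x0: "\<And>V. open V \<Longrightarrow> V \<noteq> {} \<Longrightarrow>
    (\<lambda>N. lower_dens (\<Union>r\<in>{0..N}. shift_set (return_times T x0 V) r)) \<longlonglongrightarrow> 1"
  shows "\<exists>M. ergodic_borel_prob T M \<and> full_support M"
proof -
  obtain \<C> \<K> where gen: "compact_generator \<C> \<K>"
    using ex_compact_generator by blast
  then have C: "K \<in> \<C> \<Longrightarrow> compactin tau K" "K \<in> \<C> \<Longrightarrow> interior K \<noteq> {}" for K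
    using compact_generatorD(2,3,5) by blast+
  have hit: "\<exists>N. \<forall>\<^sub>F n in sequentially. 1 - e \<le> time_avg T (indicator (entry_within T K N)) n (T x0)"
    if K: "K \<in> \<C>" and e: "e > 0" for K e
  proof -
    \<comment> \<open>The hypothesis speaks of open sets, so it is applied to the interior of
      \<open>K\<close>. The bound is then enlarged to \<open>K\<close>, whose entry sets are
      \<open>tau\<close>-compact, because lower bounds pass to the limit measure on compact
      sets.\<close>
    have "(\<lambda>N. liminf (\<lambda>n. ereal (time_avg T (indicator (entry_within T (interior K) N)) n (T x0)))) \<longlonglongrightarrow> 1"
      using x0[of "interior K"] C(2)[OF K] by (simp add: lower_dens_return_times)
    then have "\<forall>\<^sub>F N in sequentially. ereal (1 - e) < liminf (\<lambda>n. ereal (time_avg T (indicator (entry_within T (interior K) N)) n (T x0)))"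
      by (rule order_tendstoD) (use e in simp)
    then have "\<exists>N. ereal (1 - e) < liminf (\<lambda>n. ereal (time_avg T (indicator (entry_within T (interior K) N)) n (T x0)))"
      by (rule eventually_happens'[OF sequentially_bot])
    then obtain N where N: "ereal (1 - e) < liminf (\<lambda>n. ereal (time_avg T (indicator (entry_within T (interior K) N)) n (T x0)))" ..
    have "\<forall>\<^sub>F n in sequentially. ereal (1 - e) < ereal (time_avg T (indicator (entry_within T (interior K) N)) n (T x0))"
      using less_LiminfD[OF N] .
    then have "\<forall>\<^sub>F n in sequentially. 1 - e \<le> time_avg T (indicator (entry_within T K N)) n (T x0)"
    proof eventually_elim
      case (elim n)
      then show ?case
        using time_avg_indicator_mono[OF entry_within_mono[OF interior_subset[of K] order_refl[of N], of T], of T n "T x0"] by simp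
    qed
    then show ?thesis ..
  qed
  obtain K0 where K0: "K0 \<in> \<C>"
    using compact_generatorD(4)[OF gen, of UNIV] by auto
  have "\<exists>M. orbit_measure (T x0) M"
  proof (rule ex_orbit_measure)
    fix e :: real assume "e > 0"
    then show "\<exists>K. compactin tau K \<and> (\<forall>\<^sub>F n in sequentially. 1 - e \<le> time_avg T (indicator K) n (T x0))"
      using hit[OF K0] compactin_entry_within[OF C(1)[OF K0]] by blast
  qed
  then obtain M where M: "orbit_measure (T x0) M" ..
  note sets_M = orbit_measureD(1)[OF M] and ge = orbit_measureD(3)[OF M]
  have prob: "prob_space M"
    using orbit_measureD(2)[OF M] by (simp add: invariant_prob_def)
  \<comment> \<open>The limit measure along the orbit of \<open>T x0\<close> need not be ergodic;
    this full-mass property is what its components inherit.\<close>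
  have "measure M (\<Union>N. entry_within T K N) = 1" if K: "K \<in> \<C>" for K
  proof (rule measure_UN_entry_eq_1[OF prob sets_M compactin_borel[OF C(1)[OF K]]])
    show "\<exists>N. 1 - e \<le> measure M (entry_within T K N)" if "e > 0" for e
      using hit[OF K that] ge[OF compactin_entry_within[OF C(1)[OF K]]] by blast
  qed
  then show ?thesis
    by (rule ex_ergodic_component[OF M gen])
qed

end

theorem proposition2:
  fixes T :: "'a::polish_space \<Rightarrow> 'a" and tau :: "'a topology"
  assumes "continuous_on UNIV T"
    and "topspace tau = UNIV"
    and "Hausdorff_space tau"
    and "\<And>U. openin tau U \<Longrightarrow> open U"
    and "\<And>x U. open U \<Longrightarrow> x \<in> U \<Longrightarrow>
           \<exists>K. compactin tau K \<and> x \<in> interior K \<and> K \<subseteq> U"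
    and "homeomorphic_map tau tau T"
  shows "(\<exists>M. ergodic_borel_prob T M \<and> full_support M) \<longleftrightarrow>
         (\<exists>x0. \<forall>V. open V \<and> V \<noteq> {} \<longrightarrow>
            (\<lambda>N. lower_dens (\<Union>r\<in>{0..N}. shift_set (return_times T x0 V) r)) \<longlonglongrightarrow> 1)"
proof -
  interpret compactly_based_system T tau
    using assms by unfold_locales
  show ?thesis (is "?erg \<longleftrightarrow> ?pt")
  proof
    assume ?erg
    then obtain M where "ergodic_borel_prob T M" "full_support M"
      by blast
    then show ?pt
      by (rule ex_point_of_ergodic)
  next
    assume ?pt
    then obtain x0 where "\<forall>V. open V \<and> V \<noteq> {} \<longrightarrow>
        (\<lambda>N. lower_dens (\<Union>r\<in>{0..N}. shift_set (return_times T x0 V) r)) \<longlonglongrightarrow> 1" ..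
    then show ?erg
      by (intro ex_ergodic_of_point[of x0]) simp
  qed
qed

end
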